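(* Let $\mathcal{H}$ be a pure co-spherically contractive Hilbert module over $\mathbb{F}[Z_1,\dots,Z_m]$, with characteristic operator $\Theta\in\mathcal{L}(F^2_m\otimes\mathcal{E},F^2_m\otimes\mathcal{E}_* )$ for some Hilbert spaces $\mathcal{E}$ and $\mathcal{E}_*$. Then $\mathcal{H}$ is similar to $F^2_m\otimes\mathcal{F}$ for some Hilbert space $\mathcal{F}$ if and only if $\Theta$ is left invertible, that is, if and only if there exists a multi-analytic operator $\Psi:F^2_m\otimes\mathcal{E}_*\to F^2_m\otimes\mathcal{E}$ such that $$\Psi\Theta=I_{F^2_m\otimes\mathcal{E}}.$$
   Context: $\mathbb{F}[Z_1,\dots,Z_m]$ is the algebra of complex polynomials in $m$ noncommuting variables. A Hilbert module over it is a Hilbert space $\mathcal{H}$ with bounded operators $T_1,\dots,T_m$ (not necessarily commuting), where $p(Z_1,\dots,Z_m)\cdot h=p(T_1,\dots,T_m)h$. It is co-spherically contractive if the row operator $(T_1,\dots,T_m)$ is a contraction, i.e. $\sum_iT_iT_i^*\le I$; it is pure if, in addition, with $P(A)=\sum_iT_iAT_i^*$, one has $P^l(I)\to0$ in the strong operator topology as $l\to\infty$. A module map is a bounded operator commuting with the module actions; two modules are similar if there is an invertible (bounded, with bounded inverse) module map between them, and isometrically isomorphic if there is a unitary one. Quotients by closed invariant subspaces carry the quotient norm and the induced action. $F^2_m=\bigoplus_{k\ge0}(\mathbb{C}^m)^{\otimes k}$ is the full Fock space, $(\mathbb{C}^m)^{\otimes0}=\mathbb{C}$, with left creation operators $S_if=e_i\otimes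 f$, where $e_1,\dots,e_m$ is the standard basis of $\mathbb{C}^m$; $F^2_m\otimes\mathcal{E}$ is a Hilbert module with $Z_i$ acting as $S_i\otimes I_{\mathcal{E}}$. A multi-analytic operator is a bounded operator $\Theta:F^2_m\otimes\mathcal{E}\to F^2_m\otimes\mathcal{E}_*$ with $\Theta(S_i\otimes I_{\mathcal{E}})=(S_i\otimes I_{\mathcal{E}_*})\Theta$ for $i=1,\dots,m$. Characteristic operator: by a theorem of Popescu, for every pure co-spherically contractive Hilbert module $\mathcal{H}$ over $\mathbb{F}[Z_1,\dots,Z_m]$ there are Hilbert spaces $\mathcal{E},\mathcal{E}_*$ and an isometric multi-analytic operator $\Theta\in\mathcal{L}(F^2_m\otimes\mathcal{E},F^2_m\otimes\mathcal{E}_* )$ such that $\mathcal{H}$ is isometrically isomorphic to $(F^2_m\otimes\mathcal{E}_* )/\Theta(F^2_m\otimes\mathcal{E})$. Here "characteristic operator of $\mathcal{H}$" means such an isometric multi-analytic operator $\Theta$ realizing $\mathcal{H}$ as this quotient. *)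

theory Defs
  imports "HOL-Analysis.Analysis" "HOL-Library.Poly_Mapping"
begin

section \<open>Complex Hilbert spaces\<close>

text \<open>
  The inner product is linear in the first argument; the norm is the one of the underlying real
  Hilbert space, so \<open>norm x ^ 2 = cinner x x\<close>.  Separability is not assumed.
\<close>

class complex_hilbert_space = real_inner + complete_space +
  fixes scaleC :: "complex \<Rightarrow> 'a \<Rightarrow> 'a"  (infixr "*\<^sub>C" 75)
    and cinner :: "'a \<Rightarrow> 'a \<Rightarrow> complex"
  assumes scaleC_add_right: "c *\<^sub>C (x + y) = c *\<^sub>C x + c *\<^sub>C y"
    and scaleC_add_left: "(c + d) *\<^sub>C x = c *\<^sub>C x + d *\<^sub>C x"
    and scaleC_scaleC: "c *\<^sub>C d *\<^sub>C x = (c * d) *\<^sub>C x"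
    and scaleC_of_real: "complex_of_real r *\<^sub>C x = r *\<^sub>R x"
    and cinner_commute: "cinner x y = cnj (cinner y x)"
    and cinner_add_left: "cinner (x + y) z = cinner x z + cinner y z"
    and cinner_scaleC_left: "cinner (c *\<^sub>C x) y = c * cinner x y"
    and inner_eq_Re_cinner: "inner x y = Re (cinner x y)"

instantiation complex :: complex_hilbert_space
begin

definition scaleC_complex :: "complex \<Rightarrow> complex \<Rightarrow> complex"
  where "scaleC_complex c x = c * x"

definition cinner_complex :: "complex \<Rightarrow> complex \<Rightarrow> complex"
  where "cinner_complex x y = x * cnj y"

instance
  by standard
    (auto simp: scaleC_complex_def cinner_complex_def inner_complex_def algebra_simps
      scaleR_conv_of_real)

end

lemma Im_cinner_self [simp]: "Im (cinner x x) = 0"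
  using arg_cong[OF cinner_commute[of x x], of Im] by simp

lemma cinner_self: "cinner x x = complex_of_real ((norm x)\<^sup>2)"
  by (rule complex_eqI) (simp_all add: inner_eq_Re_cinner[symmetric] dot_square_norm)

lemma cinner_scaleC_right: "cinner x (c *\<^sub>C y) = cnj c * cinner x y"
  by (metis cinner_commute cinner_scaleC_left complex_cnj_mult)

lemma cinner_add_right: "cinner x (y + z) = cinner x y + cinner x z"
  by (metis cinner_commute cinner_add_left complex_cnj_add)

lemma scaleC_zero_left [simp]: "0 *\<^sub>C x = 0"
  using scaleC_of_real[of 0 x] by simp

lemma scaleC_one [simp]: "1 *\<^sub>C x = x"
  using scaleC_of_real[of 1 x] by simp

lemma scaleC_zero_right [simp]: "c *\<^sub>C 0 = 0"
  using scaleC_add_right[of c 0 0] by simp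

lemma scaleC_minus_one: "(-1) *\<^sub>C x = - x"
  using scaleC_of_real[of "-1" x] by simp

lemma norm_scaleC: "norm (c *\<^sub>C x) = cmod c * norm x"
proof -
  have "complex_of_real ((norm (c *\<^sub>C x))\<^sup>2) = c * cnj c * cinner x x"
    unfolding cinner_self[symmetric]
    by (simp add: cinner_scaleC_left cinner_scaleC_right mult_ac)
  also have "\<dots> = complex_of_real ((cmod c * norm x)\<^sup>2)"
    by (simp add: cinner_self complex_norm_square[symmetric] power_mult_distrib)
  finally have "(norm (c *\<^sub>C x))\<^sup>2 = (cmod c * norm x)\<^sup>2"
    using of_real_eq_iff by blast
  then show ?thesis by (simp add: power2_eq_iff_nonneg)
qed

lemma cinner_zero [simp]: "cinner 0 x = 0" "cinner x 0 = 0"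
  using cinner_scaleC_left[of 0 0 x] cinner_scaleC_right[of x 0 0] by simp_all

lemma norm_cinner_le: "cmod (cinner x y) \<le> norm x * norm y"
proof (cases "cinner x y = 0")
  case False
  define c where "c = cnj (sgn (cinner x y))"
  have c: "cmod c = 1" using False by (simp add: c_def norm_sgn)
  have "cinner (c *\<^sub>C x) y = complex_of_real (cmod (cinner x y))"
    using False
    by (simp add: c_def cinner_scaleC_left sgn_eq mult.commute complex_norm_square[symmetric]
        power2_eq_square)
  then have "cmod (cinner x y) = inner (c *\<^sub>C x) y"
    by (simp add: inner_eq_Re_cinner)
  also have "\<dots> \<le> norm (c *\<^sub>C x) * norm y" by (rule norm_cauchy_schwarz)
  finally show ?thesis by (simp add: norm_scaleC c)
qed simp

definition closed_csubspace :: "'a::complex_hilbert_space set \<Rightarrow> bool"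
  where "closed_csubspace K \<longleftrightarrow>
    0 \<in> K \<and> (\<forall>x\<in>K. \<forall>y\<in>K. x + y \<in> K) \<and> (\<forall>c. \<forall>x\<in>K. c *\<^sub>C x \<in> K) \<and> closed K"

definition bounded_clinear ::
    "('a::complex_hilbert_space \<Rightarrow> 'b::complex_hilbert_space) \<Rightarrow> bool"
  where "bounded_clinear A \<longleftrightarrow> bounded_linear A \<and> (\<forall>c x. A (c *\<^sub>C x) = c *\<^sub>C A x)"

text \<open>By the Riesz representation theorem the adjoint of a bounded operator exists.\<close>

definition cadjoint ::
    "('a::complex_hilbert_space \<Rightarrow> 'b::complex_hilbert_space) \<Rightarrow> 'b \<Rightarrow> 'a"
  where "cadjoint A = (THE B. \<forall>x y. cinner (A x) y = cinner x (B y))"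


section \<open>Square-summable families\<close>

typedef (overloaded) ('i, 'e::complex_hilbert_space) ell2 =
    "{f :: 'i \<Rightarrow> 'e. (\<lambda>i. (norm (f i))\<^sup>2) summable_on UNIV}"
  morphisms ell2_nth Abs_ell2
  by (rule exI[of _ "\<lambda>_. 0"]) simp

setup_lifting type_definition_ell2

lemma ell2_summable: "(\<lambda>i. (norm (ell2_nth f i))\<^sup>2) summable_on UNIV"
  using ell2_nth[of f] by simp

lemma ell2_eqI: "(\<And>i. ell2_nth f i = ell2_nth g i) \<Longrightarrow> f = g"
  by (metis ell2_nth_inject ext)

lemma square_summable_add:
  fixes f g :: "'i \<Rightarrow> 'e::real_inner"
  assumes "(\<lambda>i. (norm (f i))\<^sup>2) summable_on A" "(\<lambda>i. (norm (g i))\<^sup>2) summable_on A"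
  shows "(\<lambda>i. (norm (f i + g i))\<^sup>2) summable_on A"
proof (rule summable_on_comparison_test)
  show "(\<lambda>i. 2 * (norm (f i))\<^sup>2 + 2 * (norm (g i))\<^sup>2) summable_on A"
    by (intro summable_on_add summable_on_cmult_right assms)
  show "(norm (f i + g i))\<^sup>2 \<le> 2 * (norm (f i))\<^sup>2 + 2 * (norm (g i))\<^sup>2" for i
  proof -
    have "(norm (f i + g i))\<^sup>2 \<le> (norm (f i) + norm (g i))\<^sup>2"
      by (intro power_mono norm_triangle_ineq) simp
    also have "\<dots> \<le> 2 * (norm (f i))\<^sup>2 + 2 * (norm (g i))\<^sup>2"
      using zero_le_power2[of "norm (f i) - norm (g i)"]
      by (simp add: power2_eq_square algebra_simps)
    finally show ?thesis .
  qed
qed simp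

lemma abs_summable_product_ell2:
  "(\<lambda>i. norm (ell2_nth f i) * norm (ell2_nth g i)) summable_on UNIV"
proof (rule summable_on_comparison_test)
  show "(\<lambda>i. (norm (ell2_nth f i))\<^sup>2 + (norm (ell2_nth g i))\<^sup>2) summable_on UNIV"
    by (intro summable_on_add ell2_summable)
  show "norm (ell2_nth f i) * norm (ell2_nth g i)
      \<le> (norm (ell2_nth f i))\<^sup>2 + (norm (ell2_nth g i))\<^sup>2" for i
  proof -
    have "2 * (norm (ell2_nth f i) * norm (ell2_nth g i))
        \<le> (norm (ell2_nth f i))\<^sup>2 + (norm (ell2_nth g i))\<^sup>2"
      using zero_le_power2[of "norm (ell2_nth f i) - norm (ell2_nth g i)"]
      by (simp add: power2_eq_square algebra_simps)
    moreover have "0 \<le> norm (ell2_nth f i) * norm (ell2_nth g i)" by simp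
    ultimately show ?thesis by linarith
  qed
qed simp

lemma cinner_ell2_summable: "(\<lambda>i. cinner (ell2_nth f i) (ell2_nth g i)) summable_on UNIV"
proof (rule abs_summable_summable, rule summable_on_comparison_test)
  show "(\<lambda>i. norm (ell2_nth f i) * norm (ell2_nth g i)) summable_on UNIV"
    by (rule abs_summable_product_ell2)
qed (auto intro: norm_cinner_le)

lemma Re_cinner_ell2_summable: "(\<lambda>i. inner (ell2_nth f i) (ell2_nth g i)) summable_on UNIV"
  using summable_on_Re[OF cinner_ell2_summable[of f g]] by (simp add: inner_eq_Re_cinner)

instantiation ell2 :: (type, complex_hilbert_space) real_vector
begin

lift_definition zero_ell2 :: "('a, 'b) ell2" is "\<lambda>_. 0" by simp

lift_definition plus_ell2 :: "('a, 'b) ell2 \<Rightarrow> ('a, 'b) ell2 \<Rightarrow> ('a, 'b) ell2"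
  is "\<lambda>f g i. f i + g i" by (rule square_summable_add)

lift_definition uminus_ell2 :: "('a, 'b) ell2 \<Rightarrow> ('a, 'b) ell2"
  is "\<lambda>f i. - f i" by simp

lift_definition minus_ell2 :: "('a, 'b) ell2 \<Rightarrow> ('a, 'b) ell2 \<Rightarrow> ('a, 'b) ell2"
  is "\<lambda>f g i. f i - g i"
  using square_summable_add[where g = "\<lambda>i. - g i" for g] by fastforce

lift_definition scaleR_ell2 :: "real \<Rightarrow> ('a, 'b) ell2 \<Rightarrow> ('a, 'b) ell2"
  is "\<lambda>r f i. r *\<^sub>R f i"
  by (simp add: power_mult_distrib summable_on_cmult_right)

instance
proof
  fix x y z :: "('a, 'b) ell2" and r s :: real
  show "x + y + z = x + (y + z)" by transfer (simp add: add.assoc)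
  show "x + y = y + x" by transfer (simp add: add.commute)
  show "0 + x = x" by transfer simp
  show "- x + x = 0" by transfer simp
  show "x - y = x + - y" by transfer simp
  show "r *\<^sub>R (x + y) = r *\<^sub>R x + r *\<^sub>R y" by transfer (simp add: scaleR_add_right)
  show "(r + s) *\<^sub>R x = r *\<^sub>R x + s *\<^sub>R x" by transfer (simp add: scaleR_add_left)
  show "r *\<^sub>R s *\<^sub>R x = (r * s) *\<^sub>R x" by transfer simp
  show "1 *\<^sub>R x = x" by transfer simp
qed

end

instantiation ell2 :: (type, complex_hilbert_space) real_inner
begin

definition inner_ell2 :: "('a, 'b) ell2 \<Rightarrow> ('a, 'b) ell2 \<Rightarrow> real"
  where "inner_ell2 f g = (\<Sum>\<^sub>\<infinity>i. inner (ell2_nth f i) (ell2_nth g i))"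

definition norm_ell2 :: "('a, 'b) ell2 \<Rightarrow> real"
  where "norm_ell2 f = sqrt (inner f f)"

definition sgn_ell2 :: "('a, 'b) ell2 \<Rightarrow> ('a, 'b) ell2"
  where "sgn_ell2 f = f /\<^sub>R norm f"

definition dist_ell2 :: "('a, 'b) ell2 \<Rightarrow> ('a, 'b) ell2 \<Rightarrow> real"
  where "dist_ell2 f g = norm (f - g)"

definition uniformity_ell2 :: "(('a, 'b) ell2 \<times> ('a, 'b) ell2) filter"
  where "uniformity_ell2 = (INF e\<in>{0<..}. principal {(x, y). dist x y < e})"

definition open_ell2 :: "('a, 'b) ell2 set \<Rightarrow> bool"
  where "open_ell2 U \<longleftrightarrow> (\<forall>x\<in>U. eventually (\<lambda>(x', y). x' = x \<longrightarrow> y \<in> U) uniformity)"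

instance
proof
  fix x y z :: "('a, 'b) ell2" and r :: real and U :: "('a, 'b) ell2 set"
  show "sgn x = x /\<^sub>R norm x" by (rule sgn_ell2_def)
  show "dist x y = norm (x - y)" by (rule dist_ell2_def)
  show "uniformity = (INF e\<in>{0<..}. principal {(x :: ('a, 'b) ell2, y). dist x y < e})"
    by (rule uniformity_ell2_def)
  show "open U \<longleftrightarrow> (\<forall>x\<in>U. eventually (\<lambda>(x', y). x' = x \<longrightarrow> y \<in> U) uniformity)"
    by (rule open_ell2_def)
  show "norm x = sqrt (inner x x)" by (rule norm_ell2_def)
  show "inner x y = inner y x" by (simp add: inner_ell2_def inner_commute)
  show "inner (x + y) z = inner x z + inner y z"
    by (simp add: inner_ell2_def plus_ell2.rep_eq inner_add_left infsum_add
        Re_cinner_ell2_summable)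
  show "inner (r *\<^sub>R x) y = r * inner x y"
    by (simp add: inner_ell2_def scaleR_ell2.rep_eq infsum_cmult_right')
  show "0 \<le> inner x x" by (simp add: inner_ell2_def infsum_nonneg)
  show "inner x x = 0 \<longleftrightarrow> x = 0"
  proof
    assume 0: "inner x x = 0"
    have "inner (ell2_nth x i) (ell2_nth x i) = 0" for i
      by (rule nonneg_infsum_le_0D[where A = UNIV])
        (use 0 in \<open>auto simp: inner_ell2_def Re_cinner_ell2_summable\<close>)
    then show "x = 0" by (intro ell2_eqI) (simp add: zero_ell2.rep_eq)
  qed (simp add: inner_ell2_def zero_ell2.rep_eq)
qed

end

lemma norm_ell2_square: "(norm f)\<^sup>2 = (\<Sum>\<^sub>\<infinity>i. (norm (ell2_nth f i))\<^sup>2)"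
  for f :: "('i, 'e::complex_hilbert_space) ell2"
  by (simp add: norm_eq_sqrt_inner[of f] inner_ell2_def infsum_nonneg flip: power2_norm_eq_inner)

lemma sum_le_norm_ell2:
  fixes f :: "('i, 'e::complex_hilbert_space) ell2"
  assumes "finite A"
  shows "(\<Sum>i\<in>A. (norm (ell2_nth f i))\<^sup>2) \<le> (norm f)\<^sup>2"
  unfolding norm_ell2_square
  by (rule finite_sum_le_infsum) (auto simp: ell2_summable assms)

lemma norm_ell2_nth_le: "norm (ell2_nth f i) \<le> norm f"
  for f :: "('i, 'e::complex_hilbert_space) ell2"
  using sum_le_norm_ell2[of "{i}" f] by (simp add: power2_le_iff_abs_le)

instance ell2 :: (type, complex_hilbert_space) complete_space
proof
  fix X :: "nat \<Rightarrow> ('a, 'b) ell2"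
  assume X: "Cauchy X"
  have "Cauchy (\<lambda>n. ell2_nth (X n) i)" for i
  proof (rule metric_CauchyI)
    fix e :: real assume "0 < e"
    then obtain M where M: "\<And>m n. m \<ge> M \<Longrightarrow> n \<ge> M \<Longrightarrow> dist (X m) (X n) < e"
      using metric_CauchyD[OF X] by blast
    have "dist (ell2_nth (X m) i) (ell2_nth (X n) i) \<le> dist (X m) (X n)" for m n
      using norm_ell2_nth_le[of "X m - X n" i] by (simp add: dist_norm minus_ell2.rep_eq)
    then show "\<exists>M. \<forall>m\<ge>M. \<forall>n\<ge>M. dist (ell2_nth (X m) i) (ell2_nth (X n) i) < e"
      using M by (meson le_less_trans)
  qed
  then have "\<forall>i. \<exists>l. (\<lambda>n. ell2_nth (X n) i) \<longlonglongrightarrow> l"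
    by (simp add: Cauchy_convergent_iff convergent_def)
  then obtain g where g: "\<And>i. (\<lambda>n. ell2_nth (X n) i) \<longlonglongrightarrow> g i" by metis
  have bound: "(\<Sum>i\<in>A. (norm (ell2_nth (X n) i - g i))\<^sup>2) \<le> e\<^sup>2"
    if "finite A" and M: "\<And>m. m \<ge> M \<Longrightarrow> dist (X n) (X m) < e" for A n e M
  proof (rule tendsto_upperbound)
    show "(\<lambda>m. \<Sum>i\<in>A. (norm (ell2_nth (X n) i - ell2_nth (X m) i))\<^sup>2)
        \<longlonglongrightarrow> (\<Sum>i\<in>A. (norm (ell2_nth (X n) i - g i))\<^sup>2)"
      by (intro tendsto_intros g)
    show "\<forall>\<^sub>F m in sequentially. (\<Sum>i\<in>A. (norm (ell2_nth (X n) i - ell2_nth (X m) i))\<^sup>2) \<le> e\<^sup>2"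
      unfolding eventually_sequentially
    proof (intro exI allI impI)
      fix m assume "M \<le> m"
      have "(\<Sum>i\<in>A. (norm (ell2_nth (X n) i - ell2_nth (X m) i))\<^sup>2) \<le> (norm (X n - X m))\<^sup>2"
        using sum_le_norm_ell2[OF \<open>finite A\<close>, of "X n - X m"] by (simp add: minus_ell2.rep_eq)
      also have "\<dots> \<le> e\<^sup>2"
        using M[OF \<open>M \<le> m\<close>] by (intro power_mono) (auto simp: dist_norm)
      finally show "(\<Sum>i\<in>A. (norm (ell2_nth (X n) i - ell2_nth (X m) i))\<^sup>2) \<le> e\<^sup>2" .
    qed
  qed simp
  have diff: "(\<lambda>i. (norm (ell2_nth (X n) i - g i))\<^sup>2) summable_on UNIV"
    if "\<And>m. m \<ge> M \<Longrightarrow> dist (X n) (X m) < e" for n e M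
    by (rule nonneg_bdd_above_summable_on)
      (auto intro!: bdd_aboveI[where M = "e\<^sup>2"] bound that)
  obtain M1 where M1: "\<And>m n. m \<ge> M1 \<Longrightarrow> n \<ge> M1 \<Longrightarrow> dist (X m) (X n) < 1"
    using metric_CauchyD[OF X zero_less_one] by blast
  have "(\<lambda>i. (norm (ell2_nth (X M1) i + - (ell2_nth (X M1) i - g i)))\<^sup>2) summable_on UNIV"
    by (rule square_summable_add[OF ell2_summable])
      (use diff[OF M1[of M1, OF order_refl]] in \<open>simp add: norm_minus_commute\<close>)
  then have G: "ell2_nth (Abs_ell2 g) = g" by (simp add: Abs_ell2_inverse)
  have "X \<longlonglongrightarrow> Abs_ell2 g"
  proof (rule metric_LIMSEQ_I)
    fix e :: real assume "0 < e"
    then obtain M where M: "\<And>m n. m \<ge> M \<Longrightarrow> n \<ge> M \<Longrightarrow> dist (X m) (X n) < e / 2"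
      using metric_CauchyD[OF X, of "e / 2"] by (metis half_gt_zero)
    have "dist (X n) (Abs_ell2 g) < e" if "n \<ge> M" for n
    proof -
      have "(norm (X n - Abs_ell2 g))\<^sup>2 \<le> (e / 2)\<^sup>2"
        unfolding norm_ell2_square minus_ell2.rep_eq G
        by (rule infsum_le_finite_sums) (auto intro: diff bound M that)
      then have "norm (X n - Abs_ell2 g) \<le> e / 2"
        by (rule power2_le_imp_le) (use \<open>0 < e\<close> in simp)
      then show ?thesis using \<open>0 < e\<close> by (simp add: dist_norm)
    qed
    then show "\<exists>M. \<forall>n\<ge>M. dist (X n) (Abs_ell2 g) < e" by blast
  qed
  then show "convergent X" by (auto simp: convergent_def)
qed

instantiation ell2 :: (type, complex_hilbert_space) complex_hilbert_space
begin

lift_definition scaleC_ell2 :: "complex \<Rightarrow> ('a, 'b) ell2 \<Rightarrow> ('a, 'b) ell2"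
  is "\<lambda>c f i. c *\<^sub>C f i"
  by (simp add: norm_scaleC power_mult_distrib summable_on_cmult_right)

definition cinner_ell2 :: "('a, 'b) ell2 \<Rightarrow> ('a, 'b) ell2 \<Rightarrow> complex"
  where "cinner_ell2 f g = (\<Sum>\<^sub>\<infinity>i. cinner (ell2_nth f i) (ell2_nth g i))"

instance
proof
  fix x y z :: "('a, 'b) ell2" and c d :: complex and r :: real
  show "c *\<^sub>C (x + y) = c *\<^sub>C x + c *\<^sub>C y" by transfer (simp add: scaleC_add_right)
  show "(c + d) *\<^sub>C x = c *\<^sub>C x + d *\<^sub>C x" by transfer (simp add: scaleC_add_left)
  show "c *\<^sub>C d *\<^sub>C x = (c * d) *\<^sub>C x" by transfer (simp add: scaleC_scaleC)
  show "complex_of_real r *\<^sub>C x = r *\<^sub>R x" by transfer (simp add: scaleC_of_real)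
  show "cinner x y = cnj (cinner y x)"
    unfolding cinner_ell2_def infsum_cnj[symmetric] by (subst cinner_commute) simp
  show "cinner (x + y) z = cinner x z + cinner y z"
    by (simp add: cinner_ell2_def plus_ell2.rep_eq cinner_add_left infsum_add
        cinner_ell2_summable)
  show "cinner (c *\<^sub>C x) y = c * cinner x y"
    by (simp add: cinner_ell2_def scaleC_ell2.rep_eq cinner_scaleC_left infsum_cmult_right')
  show "inner x y = Re (cinner x y)"
    by (simp add: cinner_ell2_def inner_ell2_def inner_eq_Re_cinner infsum_Re
        cinner_ell2_summable)
qed

end


section \<open>The full Fock space\<close>

text \<open>
  The vectors \<open>e\<^sub>w = e\<^bsub>i\<^sub>1\<^esub> \<otimes> \<dots> \<otimes> e\<^bsub>i\<^sub>k\<^esub>\<close>, for \<open>w\<close> a word of length \<open>k\<close> in the letters \<open>'m\<close>, form an orthonormal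
  basis of the \<open>k\<close>-th tensor power of \<open>\<complex>\<^sup>m\<close>, where \<open>m = CARD('m)\<close>.  The full Fock space is
  therefore the space of square-summable complex families indexed by words, and its Hilbert space
  tensor product with \<open>E\<close> is the space of square-summable \<open>E\<close>-valued families: the family \<open>f\<close>
  stands for the sum of the orthogonal vectors \<open>e\<^sub>w \<otimes> f w\<close>.  The lemmas about
  \<open>fock_tensor\<close> below are the defining properties of a Hilbert space tensor product.
\<close>

type_synonym ('m, 'e) fock = "('m list, 'e) ell2"

lift_definition fock_tensor ::
    "('m, complex) fock \<Rightarrow> 'e::complex_hilbert_space \<Rightarrow> ('m, 'e) fock"
  is "\<lambda>f x w. f w *\<^sub>C x"
  by (simp add: norm_scaleC power_mult_distrib summable_on_cmult_left)

lift_definition fock_basis :: "'m list \<Rightarrow> ('m, complex) fock"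
  is "\<lambda>w v. if v = w then 1 else 0"
  by (rule finite_nonzero_values_imp_summable_on, rule finite_subset[of _ "{w}" for w]) auto

text \<open>\<open>creation i\<close> is \<open>S\<^sub>i \<otimes> I\<close>, prefixing the letter \<open>i\<close>; for \<open>'e = complex\<close> it is \<open>S\<^sub>i\<close>.\<close>

lift_definition creation ::
    "'m \<Rightarrow> ('m, 'e::complex_hilbert_space) fock \<Rightarrow> ('m, 'e) fock"
  is "\<lambda>i f w. case w of [] \<Rightarrow> 0 | j # v \<Rightarrow> if j = i then f v else 0"
proof -
  fix i :: 'm and f :: "'m list \<Rightarrow> 'e"
  assume "(\<lambda>w. (norm (f w))\<^sup>2) summable_on UNIV"
  then have "(\<lambda>w. (norm (f (tl w)))\<^sup>2) summable_on range ((#) i)"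
    by (subst summable_on_reindex) (auto simp: o_def)
  then show "(\<lambda>w. (norm (case w of [] \<Rightarrow> 0 | j # v \<Rightarrow> if j = i then f v else 0))\<^sup>2)
      summable_on UNIV"
    by (rule summable_on_cong_neutral[THEN iffD1, rotated -1]) (auto split: list.splits)
qed

lemma creation_fock_basis: "creation i (fock_basis w) = fock_basis (i # w)"
  by (rule ell2_eqI) (auto simp: creation.rep_eq fock_basis.rep_eq split: list.splits)

lemma creation_fock_tensor: "creation i (fock_tensor f x) = fock_tensor (creation i f) x"
  by (rule ell2_eqI) (auto simp: creation.rep_eq fock_tensor.rep_eq split: list.splits)

lemma norm_creation: "norm (creation i f) = norm f"
  for f :: "('m, 'e::complex_hilbert_space) fock"
proof -
  have "(norm (creation i f))\<^sup>2
      = (\<Sum>\<^sub>\<infinity>w\<in>range ((#) i). (norm (ell2_nth f (tl w)))\<^sup>2)"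
    unfolding norm_ell2_square
    by (rule infsum_cong_neutral) (auto simp: creation.rep_eq split: list.splits)
  also have "\<dots> = (norm f)\<^sup>2"
    unfolding norm_ell2_square by (subst infsum_reindex) (auto simp: o_def)
  finally show ?thesis by (simp add: power2_eq_iff_nonneg)
qed

lemma bounded_clinear_creation: "bounded_clinear (creation i)"
  unfolding bounded_clinear_def
proof (intro conjI allI bounded_linear_intro)
  fix f g :: "('a, 'b) fock" and r :: real and c :: complex
  show "creation i (f + g) = creation i f + creation i g"
    by (rule ell2_eqI) (auto simp: creation.rep_eq plus_ell2.rep_eq split: list.splits)
  show "creation i (r *\<^sub>R f) = r *\<^sub>R creation i f"
    by (rule ell2_eqI) (auto simp: creation.rep_eq scaleR_ell2.rep_eq split: list.splits)
  show "creation i (c *\<^sub>C f) = c *\<^sub>C creation i f"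
    by (rule ell2_eqI) (auto simp: creation.rep_eq scaleC_ell2.rep_eq split: list.splits)
  show "norm (creation i f) \<le> norm f * 1" by (simp add: norm_creation)
qed

lemma cinner_fock_tensor:
  "cinner (fock_tensor f x) (fock_tensor g y) = cinner f g * cinner x y"
proof -
  have "cinner (fock_tensor f x) (fock_tensor g y)
      = (\<Sum>\<^sub>\<infinity>w. cinner (ell2_nth f w) (ell2_nth g w) * cinner x y)"
    unfolding cinner_ell2_def[of "fock_tensor f x"] fock_tensor.rep_eq
    by (simp add: cinner_scaleC_left cinner_scaleC_right cinner_complex_def mult_ac)
  then show ?thesis
    by (simp add: cinner_ell2_def[of f] infsum_cmult_left')
qed

lemma fock_tensor_dense:
  "closure (span (range (\<lambda>(f, x). fock_tensor f x)))
    = (UNIV :: ('m, 'e::complex_hilbert_space) fock set)"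
proof (intro equalityI subsetI UNIV_I)
  fix f :: "('m, 'e) fock"
  have partial: "ell2_nth (\<Sum>w\<in>A. fock_tensor (fock_basis w) (ell2_nth f w)) v
      = (if v \<in> A then ell2_nth f v else 0)" if "finite A" for A v
    using that
    by (induction A)
      (auto simp: zero_ell2.rep_eq plus_ell2.rep_eq fock_tensor.rep_eq fock_basis.rep_eq)
  show "f \<in> closure (span (range (\<lambda>(f, x). fock_tensor f x)))"
    unfolding closure_approachable
  proof (intro allI impI)
    fix e :: real assume e: "0 < e"
    obtain A where A: "finite A"
      and A': "dist (\<Sum>w\<in>A. (norm (ell2_nth f w))\<^sup>2) ((norm f)\<^sup>2) < e\<^sup>2"
      using has_sum_finite_approximation[OF has_sum_infsum[OF ell2_summable[of f]], of "e\<^sup>2 / 2"] e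
      unfolding norm_ell2_square
      by (smt (verit) field_sum_of_halves zero_less_power)
    define g where "g = (\<Sum>w\<in>A. fock_tensor (fock_basis w) (ell2_nth f w))"
    have g: "g \<in> span (range (\<lambda>(f, x). fock_tensor f x))"
      unfolding g_def by (intro span_sum span_base) auto
    have "(norm (g - f))\<^sup>2 = (\<Sum>\<^sub>\<infinity>w\<in>-A. (norm (ell2_nth f w))\<^sup>2)"
      unfolding norm_ell2_square g_def minus_ell2.rep_eq partial[OF A]
      by (rule infsum_cong_neutral) auto
    also have "\<dots> = (norm f)\<^sup>2 - (\<Sum>w\<in>A. (norm (ell2_nth f w))\<^sup>2)"
    proof -
      have "(norm f)\<^sup>2 = (\<Sum>\<^sub>\<infinity>w\<in>A \<union> - A. (norm (ell2_nth f w))\<^sup>2)"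
        unfolding norm_ell2_square by simp
      also have "\<dots> = (\<Sum>\<^sub>\<infinity>w\<in>A. (norm (ell2_nth f w))\<^sup>2) + (\<Sum>\<^sub>\<infinity>w\<in>-A. (norm (ell2_nth f w))\<^sup>2)"
        by (rule infsum_Un_disjoint)
          (auto intro: summable_on_subset_banach[OF ell2_summable] simp: A)
      finally show ?thesis using A by simp
    qed
    also have "\<dots> < e\<^sup>2" using A' by (simp add: dist_real_def)
    finally have "norm (g - f) < e" using e by (simp add: power2_less_imp_less)
    then show "\<exists>y\<in>span (range (\<lambda>(f, x). fock_tensor f x)). dist y f < e"
      using g by (auto simp: dist_norm)
  qed
qed

text \<open>
  A Hilbert space may also be given as a closed subspace \<open>F\<close> of a type; \<open>fock_over F\<close> is then
  the tensor product of the Fock space with \<open>F\<close>.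
\<close>

definition fock_over :: "'e::complex_hilbert_space set \<Rightarrow> ('m, 'e) fock set"
  where "fock_over F = {f. \<forall>w. ell2_nth f w \<in> F}"

lemma fock_over_UNIV: "fock_over UNIV = UNIV"
  by (simp add: fock_over_def)


section \<open>Modules over noncommutative polynomials\<close>

text \<open>
  A polynomial in the noncommuting variables \<open>Z\<^sub>i\<close>, \<open>i :: 'm\<close>, is a finitely supported family of
  coefficients of the monomials \<open>Z\<^bsub>i\<^sub>1\<^esub> \<cdots> Z\<^bsub>i\<^sub>k\<^esub>\<close>, which are identified with words.
\<close>

type_synonym 'm nc_poly = "'m list \<Rightarrow>\<^sub>0 complex"

primrec eval_word :: "('m \<Rightarrow> 'h \<Rightarrow> 'h) \<Rightarrow> 'm list \<Rightarrow> 'h \<Rightarrow> 'h"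
  where
    "eval_word T [] h = h"
  | "eval_word T (i # w) h = T i (eval_word T w h)"

definition eval_poly ::
    "('m \<Rightarrow> 'h \<Rightarrow> 'h) \<Rightarrow> 'm nc_poly \<Rightarrow> 'h \<Rightarrow> 'h::complex_hilbert_space"
  where "eval_poly T p h = (\<Sum>w\<in>Poly_Mapping.keys p. Poly_Mapping.lookup p w *\<^sub>C eval_word T w h)"

text \<open>
  Normed modules are records, so that Hilbert modules, their submodules and quotient modules
  (whose elements are cosets) can all be compared.  The inner product of a quotient of a Hilbert
  module is determined by the quotient norm through polarization and is not recorded.
\<close>

record ('m, 'a) nc_module =
  mcarrier :: "'a set"
  madd :: "'a \<Rightarrow> 'a \<Rightarrow> 'a"
  mscale :: "complex \<Rightarrow> 'a \<Rightarrow> 'a"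
  mnorm :: "'a \<Rightarrow> real"
  mact :: "'m nc_poly \<Rightarrow> 'a \<Rightarrow> 'a"

definition hilbert_submodule ::
    "'h::complex_hilbert_space set \<Rightarrow> ('m \<Rightarrow> 'h \<Rightarrow> 'h) \<Rightarrow> ('m, 'h) nc_module"
  where "hilbert_submodule K T =
    \<lparr>mcarrier = K, madd = (+), mscale = scaleC, mnorm = norm, mact = eval_poly T\<rparr>"

abbreviation hilbert_module ::
    "('m \<Rightarrow> 'h \<Rightarrow> 'h::complex_hilbert_space) \<Rightarrow> ('m, 'h) nc_module"
  where "hilbert_module T \<equiv> hilbert_submodule UNIV T"

text \<open>
  The quotient by a submodule \<open>M\<close>.  Every operation on cosets adds an element of \<open>M\<close> explicitly, so
  that for instance multiplying by \<open>0\<close> gives the coset \<open>M\<close> and not \<open>{0}\<close>.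
\<close>

definition quotient_module :: "('m, 'a) nc_module \<Rightarrow> 'a set \<Rightarrow> ('m, 'a set) nc_module"
  where "quotient_module A M =
    \<lparr>mcarrier = {{madd A x y |y. y \<in> M} |x. x \<in> mcarrier A},
     madd = (\<lambda>X Y. {madd A (madd A x x') y |x x' y. x \<in> X \<and> x' \<in> Y \<and> y \<in> M}),
     mscale = (\<lambda>c X. {madd A (mscale A c x) y |x y. x \<in> X \<and> y \<in> M}),
     mnorm = (\<lambda>X. INF x\<in>X. mnorm A x),
     mact = (\<lambda>p X. {madd A (mact A p x) y |x y. x \<in> X \<and> y \<in> M})\<rparr>"

definition bounded_operator ::
    "('m, 'a) nc_module \<Rightarrow> ('m, 'b) nc_module \<Rightarrow> ('a \<Rightarrow> 'b) \<Rightarrow> bool"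
  where "bounded_operator A B X \<longleftrightarrow>
    (\<forall>x\<in>mcarrier A. X x \<in> mcarrier B) \<and>
    (\<forall>x\<in>mcarrier A. \<forall>y\<in>mcarrier A. X (madd A x y) = madd B (X x) (X y)) \<and>
    (\<forall>c. \<forall>x\<in>mcarrier A. X (mscale A c x) = mscale B c (X x)) \<and>
    (\<exists>C. \<forall>x\<in>mcarrier A. mnorm B (X x) \<le> C * mnorm A x)"

definition module_map ::
    "('m, 'a) nc_module \<Rightarrow> ('m, 'b) nc_module \<Rightarrow> ('a \<Rightarrow> 'b) \<Rightarrow> bool"
  where "module_map A B X \<longleftrightarrow> bounded_operator A B X \<and>
    (\<forall>p. \<forall>x\<in>mcarrier A. X (mact A p x) = mact B p (X x))"

definition similar :: "('m, 'a) nc_module \<Rightarrow> ('m, 'b) nc_module \<Rightarrow> bool"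
  where "similar A B \<longleftrightarrow> (\<exists>X Y. module_map A B X \<and> bounded_operator B A Y \<and>
    (\<forall>x\<in>mcarrier A. Y (X x) = x) \<and> (\<forall>y\<in>mcarrier B. X (Y y) = y))"

definition isometrically_isomorphic :: "('m, 'a) nc_module \<Rightarrow> ('m, 'b) nc_module \<Rightarrow> bool"
  where "isometrically_isomorphic A B \<longleftrightarrow> (\<exists>U. module_map A B U \<and>
    U ` mcarrier A = mcarrier B \<and> (\<forall>x\<in>mcarrier A. mnorm B (U x) = mnorm A x))"


section \<open>Pure co-spherically contractive modules and characteristic operators\<close>

text \<open>The norm of \<open>'h ^ 'm\<close> is the Hilbert space norm of the direct sum of \<open>m\<close> copies of \<open>'h\<close>.\<close>

definition row_operator ::
    "('m::finite \<Rightarrow> 'h \<Rightarrow> 'h) \<Rightarrow> 'h ^ 'm \<Rightarrow> 'h::complex_hilbert_space"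
  where "row_operator T h = (\<Sum>i\<in>UNIV. T i (h $ i))"

definition cospherically_contractive ::
    "('m::finite \<Rightarrow> 'h \<Rightarrow> 'h::complex_hilbert_space) \<Rightarrow> bool"
  where "cospherically_contractive T \<longleftrightarrow>
    (\<forall>i. bounded_clinear (T i)) \<and> (\<forall>h. norm (row_operator T h) \<le> norm h)"

definition cp_map ::
    "('m::finite \<Rightarrow> 'h \<Rightarrow> 'h) \<Rightarrow> ('h \<Rightarrow> 'h) \<Rightarrow> 'h \<Rightarrow> 'h::complex_hilbert_space"
  where "cp_map T A h = (\<Sum>i\<in>UNIV. T i (A (cadjoint (T i) h)))"

definition pure_cospherically_contractive ::
    "('m::finite \<Rightarrow> 'h \<Rightarrow> 'h::complex_hilbert_space) \<Rightarrow> bool"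
  where "pure_cospherically_contractive T \<longleftrightarrow>
    cospherically_contractive T \<and> (\<forall>h. (\<lambda>l. (cp_map T ^^ l) id h) \<longlonglongrightarrow> 0)"

definition multi_analytic ::
    "(('m, 'e::complex_hilbert_space) fock \<Rightarrow> ('m, 's::complex_hilbert_space) fock) \<Rightarrow> bool"
  where "multi_analytic \<Theta> \<longleftrightarrow>
    bounded_clinear \<Theta> \<and> (\<forall>i. \<Theta> \<circ> creation i = creation i \<circ> \<Theta>)"

definition characteristic_operator ::
    "('m \<Rightarrow> 'h \<Rightarrow> 'h::complex_hilbert_space) \<Rightarrow>
     (('m, 'e::complex_hilbert_space) fock \<Rightarrow> ('m, 's::complex_hilbert_space) fock) \<Rightarrow> bool"
  where "characteristic_operator T \<Theta> \<longleftrightarrow>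
    multi_analytic \<Theta> \<and> (\<forall>f. norm (\<Theta> f) = norm f) \<and>
    isometrically_isomorphic (hilbert_module T)
      (quotient_module (hilbert_module creation) (range \<Theta>))"

definition left_invertible ::
    "(('m, 'e::complex_hilbert_space) fock \<Rightarrow> ('m, 's::complex_hilbert_space) fock) \<Rightarrow> bool"
  where "left_invertible \<Theta> \<longleftrightarrow>
    (\<exists>\<Psi> :: ('m, 's) fock \<Rightarrow> ('m, 'e) fock. multi_analytic \<Psi> \<and> \<Psi> \<circ> \<Theta> = id)"

end

theory Submission
  imports Defs
begin

text \<open>
  Write \<open>S\<^sub>i\<close> for the creation operators.  The module is the quotient by the range of \<open>\<Theta>\<close>, and a left
  inverse of \<open>\<Theta>\<close> amounts to a complement of this range that is again invariant.

  If \<open>\<Psi> \<Theta> = I\<close>, then the kernel of \<open>\<Psi>\<close> is such a complement, so the quotient is similar to it.  A closed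
  invariant subspace of a Fock module is free: by the Wold decomposition it is the orthogonal sum of
  the shifts of its wandering subspace (\<open>invariant_subspace_Wold\<close>).

  Conversely, if the quotient is similar to a free module, then composing the similarity with the
  quotient map gives a multi-analytic operator \<open>A\<close> onto the free module, with the range of \<open>\<Theta>\<close> as its
  kernel.  An invariant complement of the kernel is the same as a multi-analytic right inverse \<open>B\<close> of \<open>A\<close>,
  and then \<open>\<Theta> \<Psi> = I - B A\<close> defines \<open>\<Psi>\<close>.  Free modules are not obviously projective here, since lifting
  a basis of the wandering subspace may produce an unbounded operator.  The existence of \<open>B\<close> is a
  Toeplitz corona theorem (\<open>multi_analytic_right_inverse\<close>).  Usually it is derived from commutant lifting;
  the proof given here constructs \<open>B\<close> as the adjoint of the observability operator of a
  dissipative system, found by energy estimates from \<open>A A\<^sup>* \<ge> \<epsilon>\<^sup>2\<close>.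
\<close>

section \<open>Energy minimization in Hilbert spaces\<close>

text \<open>
  The solution minimizes the energy \<open>inner (L x) x - 2 * \<phi> x\<close> over \<open>D\<close>: the minimum is attained by
  completeness, and there the first variation vanishes.  Orthogonal projections (\<open>L\<close> the identity),
  adjoints (\<open>D\<close> the whole space) and the inversion of compressed operators all come from this.
\<close>

lemma symmetric_coercive_solution:
  fixes L :: "'a::{real_inner,complete_space} \<Rightarrow> 'a" and \<phi> :: "'a \<Rightarrow> real"
  assumes D: "subspace D" "closed D"
    and L: "bounded_linear L" and \<phi>: "bounded_linear \<phi>"
    and sym: "\<And>x y. x \<in> D \<Longrightarrow> y \<in> D \<Longrightarrow> inner (L x) y = inner (L y) x"
    and c: "0 < c" "\<And>x. x \<in> D \<Longrightarrow> c * (norm x)\<^sup>2 \<le> inner (L x) x"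
  shows "\<exists>x\<in>D. \<forall>y\<in>D. inner (L x) y = \<phi> y"
proof -
  interpret L: bounded_linear L by (rule L)
  interpret \<phi>: bounded_linear \<phi> by (rule \<phi>)
  define J where "J x = inner (L x) x - 2 * \<phi> x" for x
  obtain K where K: "\<And>x. norm (\<phi> x) \<le> norm x * K" using \<phi>.bounded by blast
  have lower: "- K\<^sup>2 / c \<le> J x" if "x \<in> D" for x
  proof -
    have "\<phi> x \<le> norm x * K" using K[of x] by simp
    moreover have "0 \<le> c * (norm x - K / c)\<^sup>2" using c by simp
    then have "2 * (norm x * K) - K\<^sup>2 / c \<le> c * (norm x)\<^sup>2"
    proof -
      have "c * (norm x - K / c)\<^sup>2 = c * (norm x)\<^sup>2 - 2 * (norm x * K) + K\<^sup>2 / c"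
        using c by (simp add: power2_eq_square right_diff_distrib left_diff_distrib diff_divide_distrib
            distrib_left)
      then show ?thesis using \<open>0 \<le> c * (norm x - K / c)\<^sup>2\<close> by linarith
    qed
    ultimately show ?thesis using c(2)[OF that] unfolding J_def by linarith
  qed
  define m where "m = Inf (J ` D)"
  have bdd: "bdd_below (J ` D)" using lower by (auto intro!: bdd_belowI)
  have "0 \<in> D" using D(1) by (rule subspace_0)
  have mle: "m \<le> J x" if "x \<in> D" for x
    unfolding m_def using bdd that by (simp add: cInf_lower)
  have "\<exists>x\<in>D. J x < m + inverse (real (Suc n))" for n
    using cInf_lessD[of "J ` D" "m + inverse (real (Suc n))"] \<open>0 \<in> D\<close> by (auto simp: m_def)
  then obtain x where x: "\<And>n. x n \<in> D" "\<And>n. J (x n) < m + inverse (real (Suc n))" by metis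
  \<comment> \<open>The parallelogram law of the energy: midpoints lie in \<open>D\<close>, so almost minimal points are close.\<close>
  have close: "c * (norm (y - z))\<^sup>2 \<le> 2 * (J y - m) + 2 * (J z - m)" if "y \<in> D" "z \<in> D" for y z
  proof -
    have mid: "(1/2) *\<^sub>R (y + z) \<in> D"
      using D(1) that by (intro subspace_scale subspace_add)
    have "inner (L (y - z)) (y - z) = 2 * J y + 2 * J z - 4 * J ((1/2) *\<^sub>R (y + z))"
      by (simp add: J_def L.add L.diff L.scaleR \<phi>.add \<phi>.scaleR inner_add_left inner_add_right
          inner_diff_left inner_diff_right field_simps)
    moreover have "c * (norm (y - z))\<^sup>2 \<le> inner (L (y - z)) (y - z)"
      using D(1) that by (intro c subspace_diff)
    ultimately show ?thesis using mle[OF mid] by argo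
  qed
  have "Cauchy x"
  proof (rule metric_CauchyI)
    fix e :: real assume e: "0 < e"
    obtain M where M: "inverse (real (Suc M)) < c * e\<^sup>2 / 4"
      using reals_Archimedean[of "c * e\<^sup>2 / 4"] e c by auto
    have "dist (x i) (x j) < e" if "M \<le> i" "M \<le> j" for i j
    proof -
      have inv: "inverse (real (Suc i)) \<le> inverse (real (Suc M))"
        "inverse (real (Suc j)) \<le> inverse (real (Suc M))"
        using that by (simp_all add: field_simps)
      have "c * (norm (x i - x j))\<^sup>2 < c * e\<^sup>2"
        using close[OF x(1)[of i] x(1)[of j]] x(2)[of i] x(2)[of j] inv M by argo
      then have "(norm (x i - x j))\<^sup>2 < e\<^sup>2" using c by simp
      then show ?thesis using e by (simp add: dist_norm power2_less_imp_less)
    qed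
    then show "\<exists>M. \<forall>i\<ge>M. \<forall>j\<ge>M. dist (x i) (x j) < e" by blast
  qed
  then obtain l where l: "x \<longlonglongrightarrow> l" by (auto simp: Cauchy_convergent_iff convergent_def)
  have "l \<in> D" using D(2) x(1) l by (rule closed_sequentially)
  have "(\<lambda>n. J (x n)) \<longlonglongrightarrow> J l"
    unfolding J_def by (intro tendsto_intros L.tendsto \<phi>.tendsto l)
  moreover have "(\<lambda>n. m + inverse (real (Suc n))) \<longlonglongrightarrow> m + 0"
    by (intro tendsto_intros LIMSEQ_inverse_real_of_nat)
  ultimately have "J l \<le> m + 0"
    by (rule LIMSEQ_le) (use x(2) in \<open>auto intro: less_imp_le\<close>)
  have "inner (L l) y = \<phi> y" if y: "y \<in> D" for y
  proof -
    define b where "b = inner (L l) y - \<phi> y"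
    define a where "a = inner (L y) y"
    have "0 \<le> 2 * t * b + t\<^sup>2 * a" for t
    proof -
      have "l + t *\<^sub>R y \<in> D" using D(1) \<open>l \<in> D\<close> y by (intro subspace_add subspace_scale)
      from mle[OF this] have "J l \<le> J (l + t *\<^sub>R y)" using \<open>J l \<le> m + 0\<close> by simp
      then show ?thesis
        using sym[OF \<open>l \<in> D\<close> y]
        by (simp add: J_def L.add L.scaleR \<phi>.add \<phi>.scaleR inner_add_left inner_add_right
            a_def b_def power2_eq_square algebra_simps)
    qed
    from this[of "- b / k" for k] have *: "0 \<le> 2 * (- b / k) * b + (- b / k)\<^sup>2 * a" for k .
    define k where "k = \<bar>a\<bar> + 1"
    have k: "0 < k" "a \<le> k" by (simp_all add: k_def)
    have "0 \<le> 2 * (- b / k) * b + (- b / k)\<^sup>2 * k"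
      using *[of k] mult_left_mono[OF k(2), of "(- b / k)\<^sup>2"] by simp
    also have "\<dots> = - (b\<^sup>2 / k)" using k(1) by (simp add: power2_eq_square)
    finally have "b\<^sup>2 \<le> 0" using k(1) by (simp add: divide_le_0_iff)
    then show ?thesis by (simp add: b_def)
  qed
  then show ?thesis using \<open>l \<in> D\<close> by blast
qed

text \<open>
  The solution of the compressed equation \<open>P\<^sub>D L x = P\<^sub>D y\<close> with \<open>x \<in> D\<close>.  Solving against all
  right-hand sides in the ambient space, instead of those in \<open>D\<close>, makes the solution operator
  linear on the whole type.
\<close>

definition solve_in ::
    "'a::real_inner set \<Rightarrow> ('a \<Rightarrow> 'a) \<Rightarrow> 'a \<Rightarrow> 'a"
  where "solve_in D L y = (SOME x. x \<in> D \<and> (\<forall>d\<in>D. inner (L x) d = inner y d))"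

locale coercive =
  fixes D :: "'a::{real_inner,complete_space} set" and L :: "'a \<Rightarrow> 'a" and c :: real
  assumes subspace: "subspace D" and closed: "closed D"
    and bounded_linear: "bounded_linear L"
    and symmetric: "\<And>x y. x \<in> D \<Longrightarrow> y \<in> D \<Longrightarrow> inner (L x) y = inner (L y) x"
    and pos: "0 < c" and coercive: "\<And>x. x \<in> D \<Longrightarrow> c * (norm x)\<^sup>2 \<le> inner (L x) x"
begin

lemma solve:
  shows solve_mem: "solve_in D L y \<in> D"
    and solve_eq: "d \<in> D \<Longrightarrow> inner (L (solve_in D L y)) d = inner y d"
proof -
  have "\<exists>x. x \<in> D \<and> (\<forall>d\<in>D. inner (L x) d = inner y d)"
    using symmetric_coercive_solution[OF subspace closed bounded_linear
        bounded_linear_inner_right[of y] symmetric pos coercive] by blast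
  then have "solve_in D L y \<in> D \<and> (\<forall>d\<in>D. inner (L (solve_in D L y)) d = inner y d)"
    unfolding solve_in_def by (rule someI_ex)
  then show "solve_in D L y \<in> D" "d \<in> D \<Longrightarrow> inner (L (solve_in D L y)) d = inner y d"
    by auto
qed

lemma unique:
  assumes "x \<in> D" "x' \<in> D" "\<And>d. d \<in> D \<Longrightarrow> inner (L x) d = inner (L x') d"
  shows "x = x'"
proof -
  have d: "x - x' \<in> D" using subspace assms(1,2) by (rule subspace_diff)
  have "inner (L (x - x')) (x - x') = 0"
    using assms(3)[OF d]
    by (simp add: linear_diff[OF bounded_linear.linear[OF bounded_linear]] inner_diff_left)
  then have "c * (norm (x - x'))\<^sup>2 \<le> 0" using coercive[OF d] by simp
  then have "(norm (x - x'))\<^sup>2 \<le> 0" using pos by (simp add: mult_le_0_iff)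
  then show ?thesis by simp
qed

lemma solve_unique:
  assumes "x \<in> D" "\<And>d. d \<in> D \<Longrightarrow> inner (L x) d = inner y d"
  shows "solve_in D L y = x"
  by (rule unique) (use assms solve in auto)

lemma bounded_linear_solve: "bounded_linear (solve_in D L)"
proof (rule bounded_linear_intro[where K = "1 / c"])
  interpret L: bounded_linear L by (rule bounded_linear)
  show "solve_in D L (x + y) = solve_in D L x + solve_in D L y" for x y
    by (rule solve_unique)
      (auto simp: subspace solve L.add inner_add_left intro: subspace_add)
  show "solve_in D L (r *\<^sub>R x) = r *\<^sub>R solve_in D L x" for r x
    by (rule solve_unique)
      (auto simp: subspace solve L.scaleR intro: subspace_scale)
  show "norm (solve_in D L x) \<le> norm x * (1 / c)" for x
  proof (cases "solve_in D L x = 0")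
    case False
    have "c * (norm (solve_in D L x))\<^sup>2 \<le> inner x (solve_in D L x)"
      using coercive[OF solve_mem[of x]] solve_eq[OF solve_mem] by simp
    also have "\<dots> \<le> norm x * norm (solve_in D L x)" by (rule norm_cauchy_schwarz)
    finally have "c * norm (solve_in D L x) \<le> norm x"
      using False by (simp add: power2_eq_square mult.assoc[symmetric])
    then show ?thesis using pos by (simp add: field_simps)
  qed (use pos in simp)
qed

end

abbreviation orthproj :: "'a::real_inner set \<Rightarrow> 'a \<Rightarrow> 'a"
  where "orthproj D \<equiv> solve_in D (\<lambda>x. x)"

lemma coercive_id:
  "subspace D \<Longrightarrow> closed D \<Longrightarrow> coercive (D :: 'a::{real_inner,complete_space} set) (\<lambda>x. x) 1"
  by (rule coercive.intro) (auto simp: inner_commute power2_norm_eq_inner bounded_linear_ident)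

lemma adjoint:
  fixes A :: "'a::{real_inner,complete_space} \<Rightarrow> 'b::real_inner"
  assumes A: "bounded_linear A"
  shows inner_adjoint: "inner (A x) y = inner x (adjoint A y)"
    and bounded_linear_adjoint: "bounded_linear (adjoint A)"
proof -
  interpret A: bounded_linear A by (rule A)
  have "\<exists>z. \<forall>x. inner (A x) y = inner x z" for y
  proof -
    have \<phi>: "bounded_linear (\<lambda>x. inner (A x) y)"
      using bounded_linear_compose[OF bounded_linear_inner_left A] .
    have "\<exists>z\<in>UNIV. \<forall>x\<in>UNIV. inner z x = inner (A x) y"
      by (rule symmetric_coercive_solution[OF _ _ bounded_linear_ident \<phi>, where c = 1])
        (auto simp: inner_commute power2_norm_eq_inner)
    then obtain z where "\<And>x. inner z x = inner (A x) y" by blast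
    then have "\<forall>x. inner (A x) y = inner x z" by (simp add: inner_commute[of z])
    then show ?thesis ..
  qed
  then have "\<exists>B. \<forall>x y. inner (A x) y = inner x (B y)" by metis
  then have "\<forall>x y. inner (A x) y = inner x (adjoint A y)"
    unfolding adjoint_def by (rule someI_ex)
  then have eq: "inner (A x) y = inner x (adjoint A y)" for x y by blast
  show "inner (A x) y = inner x (adjoint A y)" by (rule eq)
  obtain K where K: "0 < K" "\<And>x. norm (A x) \<le> norm x * K" using A.pos_bounded by blast
  show "bounded_linear (adjoint A)"
  proof (rule bounded_linear_intro[where K = K])
    show "adjoint A (x + y) = adjoint A x + adjoint A y" for x y
      by (rule vector_eq_ldot[THEN iffD1]) (simp add: inner_add_right eq[symmetric])
    show "adjoint A (r *\<^sub>R x) = r *\<^sub>R adjoint A x" for r x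
      by (rule vector_eq_ldot[THEN iffD1]) (simp add: eq[symmetric])
    show "norm (adjoint A y) \<le> norm y * K" for y
    proof (cases "adjoint A y = 0")
      case False
      have "(norm (adjoint A y))\<^sup>2 = inner (A (adjoint A y)) y"
        by (simp add: eq power2_norm_eq_inner)
      also have "\<dots> \<le> norm (A (adjoint A y)) * norm y" by (rule norm_cauchy_schwarz)
      also have "\<dots> \<le> norm (adjoint A y) * K * norm y"
        by (intro mult_right_mono K) simp
      finally show ?thesis using False by (simp add: power2_eq_square mult_ac)
    qed (use K in simp)
  qed
qed

text \<open>
  This form of the Cauchy-Schwarz inequality is applied in the energy estimates, where the last
  summand is absorbed into the left-hand side.
\<close>

lemma two_inner_le: "2 * inner x y \<le> (norm x)\<^sup>2 + (norm y)\<^sup>2" for x y :: "'x::real_inner"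
  using inner_ge_zero[of "x - y"]
  by (simp add: power2_norm_eq_inner inner_diff_left inner_diff_right inner_commute)

section \<open>Complex linearity\<close>

lemma inner_scaleC_left: "inner (c *\<^sub>C x) y = inner x (cnj c *\<^sub>C y)"
  by (simp add: inner_eq_Re_cinner cinner_scaleC_left cinner_scaleC_right)

lemma scaleR_scaleC: "r *\<^sub>R x = complex_of_real r *\<^sub>C x"
  by (simp add: scaleC_of_real)

lemma bounded_clinear_linear: "bounded_clinear A \<Longrightarrow> bounded_linear A"
  by (simp add: bounded_clinear_def)

lemma bounded_clinear_adjoint:
  assumes "bounded_clinear A"
  shows "bounded_clinear (adjoint A)"
proof -
  have A: "bounded_linear A" and AC: "\<And>c x. A (c *\<^sub>C x) = c *\<^sub>C A x"
    using assms by (auto simp: bounded_clinear_def)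
  have "adjoint A (c *\<^sub>C y) = c *\<^sub>C adjoint A y" for c y
  proof (rule vector_eq_ldot[THEN iffD1], rule allI)
    fix x
    have "inner x (adjoint A (c *\<^sub>C y)) = inner (A (cnj c *\<^sub>C x)) y"
      by (simp add: inner_adjoint[OF A, symmetric] AC inner_scaleC_left)
    then show "inner x (adjoint A (c *\<^sub>C y)) = inner x (c *\<^sub>C adjoint A y)"
      by (simp add: inner_adjoint[OF A] inner_scaleC_left)
  qed
  then show ?thesis using bounded_linear_adjoint[OF A] by (simp add: bounded_clinear_def)
qed

lemma closed_csubspace_subspace:
  assumes "closed_csubspace D"
  shows "subspace D" "closed D" "\<And>c x. x \<in> D \<Longrightarrow> c *\<^sub>C x \<in> D"
  using assms by (auto simp: closed_csubspace_def subspace_def scaleR_scaleC)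

lemma bounded_clinear_orthproj:
  assumes D: "closed_csubspace D"
  shows "bounded_clinear (orthproj D)"
proof -
  interpret coercive D "\<lambda>x. x" 1
    by (rule coercive_id) (use closed_csubspace_subspace[OF D] in auto)
  have "orthproj D (c *\<^sub>C x) = c *\<^sub>C orthproj D x" for c x
    by (rule solve_unique)
      (auto simp: inner_scaleC_left solve closed_csubspace_subspace[OF D])
  then show ?thesis using bounded_linear_solve by (simp add: bounded_clinear_def)
qed

lemma bounded_clinear_compose:
  "bounded_clinear A \<Longrightarrow> bounded_clinear B \<Longrightarrow> bounded_clinear (\<lambda>x. A (B x))"
  by (auto simp: bounded_clinear_def intro: bounded_linear_compose)

lemma bounded_clinear_diff:
  fixes A B :: "'a::complex_hilbert_space \<Rightarrow> 'b::complex_hilbert_space"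
  shows "bounded_clinear A \<Longrightarrow> bounded_clinear B \<Longrightarrow> bounded_clinear (\<lambda>x. A x - B x)"
proof -
  have "c *\<^sub>C (x - y) = c *\<^sub>C x - c *\<^sub>C y" for c and x y :: 'b
    using scaleC_add_right[of c "x - y" y] by (simp add: algebra_simps)
  then show "bounded_clinear A \<Longrightarrow> bounded_clinear B \<Longrightarrow> bounded_clinear (\<lambda>x. A x - B x)"
    by (auto simp: bounded_clinear_def intro: bounded_linear_sub)
qed

lemma scaleC_sum_right: "c *\<^sub>C (\<Sum>i\<in>I. f i) = (\<Sum>i\<in>I. c *\<^sub>C f i)"
  by (induction I rule: infinite_finite_induct) (auto simp: scaleC_add_right)

lemma bounded_clinear_sum:
  "(\<And>i. i \<in> I \<Longrightarrow> bounded_clinear (A i)) \<Longrightarrow> bounded_clinear (\<lambda>x. \<Sum>i\<in>I. A i x)"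
  by (auto simp: bounded_clinear_def scaleC_sum_right intro: bounded_linear_sum)

section \<open>Annihilation operators\<close>

lift_definition annihilation ::
    "'m \<Rightarrow> ('m, 'e::complex_hilbert_space) fock \<Rightarrow> ('m, 'e) fock"
  is "\<lambda>i f w. f (i # w)"
proof -
  fix i :: 'm and f :: "'m list \<Rightarrow> 'e"
  assume "(\<lambda>w. (norm (f w))\<^sup>2) summable_on UNIV"
  then have "(\<lambda>w. (norm (f w))\<^sup>2) summable_on range ((#) i)"
    by (rule summable_on_subset_banach) simp
  then show "(\<lambda>w. (norm (f (i # w)))\<^sup>2) summable_on UNIV"
    by (subst (asm) summable_on_reindex) (auto simp: o_def)
qed

abbreviation vacuum :: "'e::complex_hilbert_space \<Rightarrow> ('m, 'e) fock"
  where "vacuum \<equiv> fock_tensor (fock_basis [])"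

lemma nth_vacuum: "ell2_nth (vacuum x) w = (if w = [] then x else 0)"
  by (simp add: fock_tensor.rep_eq fock_basis.rep_eq)

lemma ell2_nth_sum: "ell2_nth (\<Sum>i\<in>I. f i) w = (\<Sum>i\<in>I. ell2_nth (f i) w)"
  by (induction I rule: infinite_finite_induct) (auto simp: zero_ell2.rep_eq plus_ell2.rep_eq)

lemma inner_vacuum_left: "inner (vacuum x) f = inner x (ell2_nth f [])"
proof -
  have "inner (vacuum x) f = (\<Sum>\<^sub>\<infinity>w\<in>{[]}. inner x (ell2_nth f w))"
    unfolding inner_ell2_def by (rule infsum_cong_neutral) (auto simp: nth_vacuum)
  then show ?thesis by simp
qed

lemma inner_vacuum_right: "inner f (vacuum x) = inner (ell2_nth f []) x"
  by (metis inner_commute inner_vacuum_left)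

lemma inner_creation_left:
  fixes f g :: "('m, 'e::complex_hilbert_space) fock"
  shows "inner (creation i f) g = inner f (annihilation i g)"
proof -
  have "inner (creation i f) g = (\<Sum>\<^sub>\<infinity>w\<in>range ((#) i). inner (ell2_nth f (tl w)) (ell2_nth g w))"
    unfolding inner_ell2_def
    by (rule infsum_cong_neutral) (auto simp: creation.rep_eq split: list.splits)
  also have "\<dots> = inner f (annihilation i g)"
    unfolding inner_ell2_def
    by (subst infsum_reindex) (auto simp: o_def annihilation.rep_eq)
  finally show ?thesis .
qed

lemma inner_creation_right:
  fixes f g :: "('m, 'e::complex_hilbert_space) fock"
  shows "inner g (creation i f) = inner (annihilation i g) f"
  by (metis inner_commute inner_creation_left)

lemma annihilation_creation: "annihilation j (creation i f) = (if i = j then f else 0)"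
  by (rule ell2_eqI) (auto simp: annihilation.rep_eq creation.rep_eq zero_ell2.rep_eq)

lemma fock_decomposition:
  fixes f :: "('m::finite, 'e::complex_hilbert_space) fock"
  shows "f = vacuum (ell2_nth f []) + (\<Sum>i\<in>UNIV. creation i (annihilation i f))"
proof (rule ell2_eqI)
  fix w
  show "ell2_nth f w
      = ell2_nth (vacuum (ell2_nth f []) + (\<Sum>i\<in>UNIV. creation i (annihilation i f))) w"
    by (cases w) (auto simp: plus_ell2.rep_eq ell2_nth_sum nth_vacuum creation.rep_eq
        annihilation.rep_eq)
qed

lemma inner_fock_decomposition:
  fixes f :: "('m::finite, 'e::complex_hilbert_space) fock"
  shows "inner f g = inner (ell2_nth f []) (ell2_nth g [])
    + (\<Sum>i\<in>UNIV. inner (annihilation i f) (annihilation i g))"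
  by (subst fock_decomposition[of f])
    (simp add: inner_add_left inner_sum_left inner_vacuum_left inner_creation_left)

lemma norm_fock_decomposition:
  fixes f :: "('m::finite, 'e::complex_hilbert_space) fock"
  shows "(norm f)\<^sup>2 = (norm (ell2_nth f []))\<^sup>2 + (\<Sum>i\<in>UNIV. (norm (annihilation i f))\<^sup>2)"
  by (simp add: power2_norm_eq_inner inner_fock_decomposition[of f f])

lemma bounded_clinear_annihilation:
  "bounded_clinear (annihilation (i::'m::finite) :: ('m, 'e::complex_hilbert_space) fock \<Rightarrow> _)"
  unfolding bounded_clinear_def
proof (intro conjI allI bounded_linear_intro)
  fix f g :: "('m, 'e) fock" and r :: real and c :: complex
  show "annihilation i (f + g) = annihilation i f + annihilation i g"
    by (rule ell2_eqI) (simp add: annihilation.rep_eq plus_ell2.rep_eq)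
  show "annihilation i (r *\<^sub>R f) = r *\<^sub>R annihilation i f"
    by (rule ell2_eqI) (simp add: annihilation.rep_eq scaleR_ell2.rep_eq)
  show "annihilation i (c *\<^sub>C f) = c *\<^sub>C annihilation i f"
    by (rule ell2_eqI) (simp add: annihilation.rep_eq scaleC_ell2.rep_eq)
  have "(norm (annihilation i f))\<^sup>2 \<le> (\<Sum>i\<in>UNIV. (norm (annihilation i f))\<^sup>2)"
    by (rule member_le_sum) auto
  then have "(norm (annihilation i f))\<^sup>2 \<le> (norm f)\<^sup>2"
    using norm_fock_decomposition[of f] zero_le_power2[of "norm (ell2_nth f [])"] by linarith
  then show "norm (annihilation i f) \<le> norm f * 1"
    by (auto intro: power2_le_imp_le)
qed

lemma bounded_clinear_vacuum:
  "bounded_clinear (vacuum :: 'e::complex_hilbert_space \<Rightarrow> ('m, 'e) fock)"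
  unfolding bounded_clinear_def
proof (intro conjI allI bounded_linear_intro)
  fix x y :: 'e and r :: real and c :: complex
  show "vacuum (x + y) = vacuum x + vacuum y"
    by (rule ell2_eqI) (simp add: nth_vacuum plus_ell2.rep_eq)
  show "vacuum (r *\<^sub>R x) = r *\<^sub>R vacuum x"
    by (rule ell2_eqI) (simp add: nth_vacuum scaleR_ell2.rep_eq)
  show "vacuum (c *\<^sub>C x) = c *\<^sub>C vacuum x"
    by (rule ell2_eqI) (simp add: nth_vacuum scaleC_ell2.rep_eq)
  have "(norm (vacuum x :: ('m, 'e) fock))\<^sup>2 = (norm x)\<^sup>2"
    by (simp add: power2_norm_eq_inner inner_vacuum_left nth_vacuum)
  then show "norm (vacuum x :: ('m, 'e) fock) \<le> norm x * 1"
    by (simp add: power2_eq_iff_nonneg)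
qed

lemma bounded_clinear_ell2_nth: "bounded_clinear (\<lambda>f. ell2_nth f w)"
  unfolding bounded_clinear_def
  by (intro conjI allI bounded_linear_intro[where K = 1])
    (simp_all add: plus_ell2.rep_eq scaleR_ell2.rep_eq scaleC_ell2.rep_eq norm_ell2_nth_le)

lemma creation_linear: "bounded_linear (creation i)"
  by (rule bounded_clinear_linear) (rule bounded_clinear_creation)

lemma creation_scaleC: "creation i (c *\<^sub>C f) = c *\<^sub>C creation i f"
  by (rule ell2_eqI) (auto simp: creation.rep_eq scaleC_ell2.rep_eq split: list.splits)

lemma annihilation_linear:
  "bounded_linear (annihilation (i::'m::finite) :: ('m, 'x::complex_hilbert_space) fock \<Rightarrow> _)"
  by (rule bounded_clinear_linear) (rule bounded_clinear_annihilation)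

lemma nth_linear: "bounded_linear (\<lambda>f. ell2_nth f w)"
  by (rule bounded_clinear_linear) (rule bounded_clinear_ell2_nth)

lemma vacuum_linear:
  "bounded_linear (vacuum :: 'x::complex_hilbert_space \<Rightarrow> ('m, 'x) fock)"
  by (rule bounded_clinear_linear) (rule bounded_clinear_vacuum)

text \<open>
  An operator that reproduces itself through the creation operators has no coefficient at the empty
  word, hence none at words of length one, and so on.  This replaces convergence arguments
  for the Wold expansion \<open>\<Sum>w. S\<^sub>w c\<^sub>w\<close>: identities between such expansions need only be checked one
  step at a time.
\<close>

lemma zero_if_shifted:
  fixes E :: "'z \<Rightarrow> ('m::finite, 'e::complex_hilbert_space) fock"
  assumes E: "\<And>z. z \<in> Z \<Longrightarrow> E z = (\<Sum>i\<in>UNIV. creation i (E (\<sigma> i z)))"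
    and \<sigma>: "\<And>i z. z \<in> Z \<Longrightarrow> \<sigma> i z \<in> Z"
    and z: "z \<in> Z"
  shows "E z = 0"
proof (rule ell2_eqI)
  fix w
  from z show "ell2_nth (E z) w = ell2_nth 0 w"
  proof (induction w arbitrary: z)
    case Nil
    show ?case by (subst E[OF Nil]) (simp add: ell2_nth_sum creation.rep_eq zero_ell2.rep_eq)
  next
    case (Cons j v)
    have "ell2_nth (E (\<sigma> i z)) v = 0" for i
      using Cons.IH[OF \<sigma>[OF Cons.prems]] by (simp add: zero_ell2.rep_eq)
    then show ?case
      by (subst E[OF Cons.prems]) (simp add: ell2_nth_sum creation.rep_eq zero_ell2.rep_eq)
  qed
qed

section \<open>Observability operators\<close>

text \<open>
  A linear system branches along the letters: in the state \<open>x\<close> it emits \<open>c x\<close> and moves to \<open>\<tau> i x\<close>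
  on reading \<open>i\<close>.  Collecting the outputs along all words gives a vector of the Fock space that
  intertwines \<open>\<tau> i\<close> with the annihilation operators.  If a storage function pays for the outputs, then
  this vector is square-summable, with squared norm bounded by the initial storage.  The corona
  construction and the Wold decomposition both rest on operators of this form and their adjoints.
\<close>

primrec run :: "('m \<Rightarrow> 'z \<Rightarrow> 'z) \<Rightarrow> 'm list \<Rightarrow> 'z \<Rightarrow> 'z"
  where
    "run \<tau> [] x = x"
  | "run \<tau> (i # w) x = run \<tau> w (\<tau> i x)"

definition observe ::
    "('m \<Rightarrow> 'z \<Rightarrow> 'z) \<Rightarrow> ('z \<Rightarrow> 'e) \<Rightarrow> 'z \<Rightarrow> ('m, 'e::complex_hilbert_space) fock"
  where "observe \<tau> c x = Abs_ell2 (\<lambda>w. c (run \<tau> w x))"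

locale dissipative_system =
  fixes \<tau> :: "'m::finite \<Rightarrow> 'z::real_normed_vector \<Rightarrow> 'z"
    and c :: "'z \<Rightarrow> 'e::complex_hilbert_space"
    and G :: "'z \<Rightarrow> real" and K :: real
  assumes bounded_linear_state: "\<And>i. bounded_linear (\<tau> i)"
    and bounded_linear_output: "bounded_linear c"
    and storage_nonneg: "\<And>x. 0 \<le> G x"
    and storage_bounded: "\<And>x. G x \<le> (K * norm x)\<^sup>2"
    and dissipation: "\<And>x. (norm (c x))\<^sup>2 + (\<Sum>i\<in>UNIV. G (\<tau> i x)) \<le> G x"
begin

lemma finite_words: "finite {w :: 'm list. length w < n}"
  by (rule finite_subset[OF _ finite_lists_length_le[of UNIV n]]) auto

text \<open>
  The dissipation inequality telescopes along the tree of words.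
\<close>

lemma output_energy: "(\<Sum>w | length w < n. (norm (c (run \<tau> w x)))\<^sup>2) \<le> G x"
proof (induction n arbitrary: x)
  case 0
  show ?case by (simp add: storage_nonneg)
next
  case (Suc n)
  have split: "{w :: 'm list. length w < Suc n}
      = insert [] (\<Union>i. (#) i ` {w. length w < n})"
    by (auto simp: image_iff) (metis Suc_less_eq length_Suc_conv list.size(3) neq_Nil_conv
        length_Cons)
  have "(\<Sum>w | length w < Suc n. (norm (c (run \<tau> w x)))\<^sup>2)
      = (norm (c x))\<^sup>2 + (\<Sum>w\<in>(\<Union>i. (#) i ` {w. length w < n}). (norm (c (run \<tau> w x)))\<^sup>2)"
    unfolding split by (subst sum.insert) (auto simp: finite_words)
  also have "(\<Sum>w\<in>(\<Union>i. (#) i ` {w. length w < n}). (norm (c (run \<tau> w x)))\<^sup>2)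
      = (\<Sum>i\<in>UNIV. \<Sum>w | length w < n. (norm (c (run \<tau> w (\<tau> i x))))\<^sup>2)"
    by (subst sum.UNION_disjoint) (auto simp: finite_words sum.reindex)
  also have "\<dots> \<le> (\<Sum>i\<in>UNIV. G (\<tau> i x))" by (intro sum_mono Suc.IH)
  finally show ?case using dissipation[of x] by linarith
qed

lemma finite_output_energy:
  assumes "finite A"
  shows "(\<Sum>w\<in>A. (norm (c (run \<tau> w x)))\<^sup>2) \<le> G x"
proof -
  define n where "n = Suc (Max (length ` A))"
  have n: "length w < n" if "w \<in> A" for w
    using assms that by (simp add: n_def less_Suc_eq_le)
  have "(\<Sum>w\<in>A. (norm (c (run \<tau> w x)))\<^sup>2) \<le> (\<Sum>w | length w < n. (norm (c (run \<tau> w x)))\<^sup>2)"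
    by (rule sum_mono2) (auto simp: finite_words n)
  then show ?thesis using output_energy[where n = n and x = x] by linarith
qed

lemma output_summable: "(\<lambda>w. (norm (c (run \<tau> w x)))\<^sup>2) summable_on UNIV"
  by (rule nonneg_bdd_above_summable_on)
    (auto intro!: bdd_aboveI[where M = "G x"] finite_output_energy)

lemma nth_observe: "ell2_nth (observe \<tau> c x) w = c (run \<tau> w x)"
  unfolding observe_def by (subst Abs_ell2_inverse) (auto simp: output_summable)

lemma norm_observe: "(norm (observe \<tau> c x))\<^sup>2 \<le> G x"
  unfolding norm_ell2_square nth_observe
  by (rule infsum_le_finite_sums[OF output_summable]) (rule finite_output_energy)

lemma annihilation_observe: "annihilation i (observe \<tau> c x) = observe \<tau> c (\<tau> i x)"
  by (rule ell2_eqI) (simp add: annihilation.rep_eq nth_observe)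

lemma observe_decomposition:
  "observe \<tau> c x = vacuum (c x) + (\<Sum>i\<in>UNIV. creation i (observe \<tau> c (\<tau> i x)))"
  by (subst fock_decomposition) (simp add: annihilation_observe nth_observe)

lemma bounded_linear_observe: "bounded_linear (observe \<tau> c)"
proof (rule bounded_linear_intro[where K = "\<bar>K\<bar>"])
  have run_add: "run \<tau> w (x + y) = run \<tau> w x + run \<tau> w y" for w x y
    by (induction w arbitrary: x y) (auto simp: bounded_linear_state linear_simps)
  have run_scale: "run \<tau> w (r *\<^sub>R x) = r *\<^sub>R run \<tau> w x" for w r x
    by (induction w arbitrary: x) (auto simp: bounded_linear_state linear_simps)
  show "observe \<tau> c (x + y) = observe \<tau> c x + observe \<tau> c y" for x y
    by (rule ell2_eqI)
      (simp add: nth_observe plus_ell2.rep_eq run_add linear_simps[OF bounded_linear_output])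
  show "observe \<tau> c (r *\<^sub>R x) = r *\<^sub>R observe \<tau> c x" for r x
    by (rule ell2_eqI)
      (simp add: nth_observe scaleR_ell2.rep_eq run_scale linear_simps[OF bounded_linear_output])
  show "norm (observe \<tau> c x) \<le> norm x * \<bar>K\<bar>" for x
  proof (rule power2_le_imp_le)
    show "(norm (observe \<tau> c x))\<^sup>2 \<le> (norm x * \<bar>K\<bar>)\<^sup>2"
      using order_trans[OF norm_observe storage_bounded[of x]]
      by (simp add: power_mult_distrib mult.commute)
  qed simp
qed

end

lemma bounded_clinear_observe:
  fixes \<tau> :: "'m::finite \<Rightarrow> 'z::complex_hilbert_space \<Rightarrow> 'z"
  assumes "dissipative_system \<tau> c G K"
    and "\<And>i. bounded_clinear (\<tau> i)" "bounded_clinear c"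
  shows "bounded_clinear (observe \<tau> c)"
proof -
  interpret dissipative_system \<tau> c G K by fact
  have "run \<tau> w (a *\<^sub>C x) = a *\<^sub>C run \<tau> w x" for w a x
    using assms(2) by (induction w arbitrary: x) (auto simp: bounded_clinear_def)
  then have "observe \<tau> c (a *\<^sub>C x) = a *\<^sub>C observe \<tau> c x" for a x
    using assms(3)
    by (intro ell2_eqI) (simp add: nth_observe scaleC_ell2.rep_eq bounded_clinear_def)
  then show ?thesis using bounded_linear_observe by (simp add: bounded_clinear_def)
qed

section \<open>Right inverses of surjective multi-analytic operators\<close>

text \<open>
  This is the Toeplitz corona theorem (Leech's theorem) on the full Fock space: a multi-analytic
  operator \<open>A\<close> onto a reducing subspace \<open>D\<close> has a multi-analytic right inverse.  The pseudoinverse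
  \<open>A\<^sup>* (A A\<^sup>*)\<^sup>-\<^sup>1\<close> is a bounded right inverse, but it need not commute with the creation operators.  One
  that does comes from the following realization.

  Surjectivity makes \<open>L = A A\<^sup>* - \<delta>\<close> positive on \<open>D\<close> for small \<open>\<delta>\<close>.  Let \<open>P\<^sub>0 = 1 - (\<Sum>i. S\<^sub>i S\<^sub>i\<^sup>*)\<close>, the
  projection onto the coefficient at the empty word, and \<open>x\<^sub>0\<close> this coefficient of \<open>x\<close>.  Since \<open>A\<close>
  commutes with the \<open>S\<^sub>i\<close>, the operator \<open>M = L + \<delta> P\<^sub>0\<close> is equal to \<open>(\<Sum>i. S\<^sub>i L S\<^sub>i\<^sup>*) + A P\<^sub>0 A\<^sup>*\<close>.  The two
  expressions compute one energy in two ways: with \<open>q x = inner (L x) x\<close>,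
  \<open>q x + \<delta> * (norm x\<^sub>0)\<^sup>2 = (\<Sum>i. q (S\<^sub>i\<^sup>* x)) + (norm (A\<^sup>* x)\<^sub>0)\<^sup>2\<close>.

  One looks for an operator \<open>s\<close> with \<open>s (A\<^sup>* x) = x\<close> that turns this equation for \<open>y = A\<^sup>* x\<close> into an
  inequality for all \<open>y\<close>,
  \<open>q (s y) + \<delta> * (norm (s y)\<^sub>0)\<^sup>2 \<le> (\<Sum>i. q (s (S\<^sub>i\<^sup>* y))) + (norm y\<^sub>0)\<^sup>2\<close>.
  It says that \<open>y \<mapsto> (s y)\<^sub>0\<close>, observed along the annihilation operators, is a dissipative system with
  storage \<open>(norm y)\<^sup>2 - q (s y)\<close> up to the factor \<open>\<delta>\<close>.  Its observability operator \<open>Q\<close> inverts \<open>A\<^sup>*\<close> from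
  the left and commutes with the annihilation operators, so that its adjoint is the desired right
  inverse of \<open>A\<close>.

  The natural \<open>s\<close> is recursive: \<open>s y\<close> is the \<open>x\<close> whose data \<open>S\<^sub>i\<^sup>* x\<close>, \<open>(A\<^sup>* x)\<^sub>0\<close> are closest to the given
  \<open>s (S\<^sub>i\<^sup>* y)\<close>, \<open>y\<^sub>0\<close> in the energy, that is, \<open>s y = M\<^sup>-\<^sup>1 (A P\<^sub>0 y + (\<Sum>i. S\<^sub>i L (s (S\<^sub>i\<^sup>* y))))\<close>.  This recursion
  does not end, but its dual can be solved directly: the adjoint \<open>t\<close> of \<open>s\<close> with respect to the energy
  \<open>q\<close> is itself the observability operator of a system with state space \<open>D\<close>.
\<close>

locale surjective_multi_analytic =
  fixes A :: "('m::finite, 's::complex_hilbert_space) fock \<Rightarrow>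
      ('m, 'f::complex_hilbert_space) fock"
    and D :: "('m, 'f) fock set" and \<epsilon> :: real
  assumes A: "bounded_linear A" and A_creation: "\<And>i f. A (creation i f) = creation i (A f)"
    and A_mem: "\<And>f. A f \<in> D"
    and D: "subspace D" "closed D"
    and creation_mem: "\<And>i f. f \<in> D \<Longrightarrow> creation i f \<in> D"
    and annihilation_mem: "\<And>i f. f \<in> D \<Longrightarrow> annihilation i f \<in> D"
    and \<epsilon>: "0 < \<epsilon>" "\<And>f. f \<in> D \<Longrightarrow> \<epsilon> * norm f \<le> norm (adjoint A f)"
begin

abbreviation A' where "A' \<equiv> adjoint A"

text \<open>
  Half of the available lower bound of \<open>A A\<^sup>*\<close>, so that \<open>L\<close> stays coercive on \<open>D\<close>.
\<close>

definition \<delta> where "\<delta> = \<epsilon>\<^sup>2 / 2"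

definition L where "L x = A (A' x) - \<delta> *\<^sub>R x"

definition q where "q x = (norm (A' x))\<^sup>2 - \<delta> * (norm x)\<^sup>2"

definition M where "M x = L x + \<delta> *\<^sub>R vacuum (ell2_nth x [])"

lemma \<delta>: "0 < \<delta>" using \<epsilon> by (simp add: \<delta>_def)

lemma inner_A: "inner (A x) y = inner x (A' y)"
  by (rule inner_adjoint[OF A])

lemma inner_L: "inner (L x) y = inner (A' x) (A' y) - \<delta> * inner x y"
  by (simp add: L_def inner_diff_left inner_A)

lemma inner_L_commute: "inner (L x) y = inner (L y) x"
  by (simp only: inner_L inner_commute[of "A' x"] inner_commute[of x y])

lemma inner_L_self: "inner (L x) x = q x"
  by (simp add: inner_L q_def power2_norm_eq_inner)

lemma inner_M: "inner (M x) y = inner (L x) y + \<delta> * inner (ell2_nth x []) (ell2_nth y [])"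
  by (simp add: M_def inner_add_left inner_vacuum_left)

lemma vacuum_mem: "x \<in> D \<Longrightarrow> vacuum (ell2_nth x []) \<in> D"
proof -
  assume x: "x \<in> D"
  have "vacuum (ell2_nth x []) = x - (\<Sum>i\<in>UNIV. creation i (annihilation i x))"
    by (subst (2) fock_decomposition) simp
  then show ?thesis
    using D(1) x by (auto intro!: subspace_diff subspace_sum creation_mem annihilation_mem)
qed

lemma L_mem: "x \<in> D \<Longrightarrow> L x \<in> D"
  using D(1) by (auto simp: L_def intro!: subspace_diff subspace_scale A_mem)

lemma M_mem: "x \<in> D \<Longrightarrow> M x \<in> D"
  using D(1) by (auto simp: M_def intro!: subspace_add subspace_scale L_mem vacuum_mem)

lemma L_linear: "bounded_linear L"
  unfolding L_def[abs_def]
  by (intro bounded_linear_sub bounded_linear_compose[OF A] bounded_linear_adjoint A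
      bounded_linear_scaleR_right)

lemma M_linear: "bounded_linear M"
  unfolding M_def[abs_def]
  by (intro bounded_linear_add L_linear bounded_linear_compose[OF bounded_linear_scaleR_right]
      bounded_linear_compose[OF vacuum_linear nth_linear])

lemma q_lower: "x \<in> D \<Longrightarrow> \<delta> * (norm x)\<^sup>2 \<le> q x"
proof -
  assume "x \<in> D"
  then have "(\<epsilon> * norm x)\<^sup>2 \<le> (norm (A' x))\<^sup>2" using \<epsilon> by (intro power_mono) auto
  then show ?thesis by (simp add: q_def \<delta>_def power_mult_distrib)
qed

lemma q_nonneg: "x \<in> D \<Longrightarrow> 0 \<le> q x"
  using q_lower[of x] \<delta> by (smt (verit) mult_nonneg_nonneg zero_le_power2)

lemma q_young:
  assumes "x \<in> D" "y \<in> D"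
  shows "2 * inner (L x) y \<le> q x + q y"
proof -
  have "q (x - y) = q x + q y - 2 * inner (L x) y"
    unfolding inner_L_self[symmetric] linear_simps[OF L_linear]
    by (simp add: inner_diff_left inner_diff_right inner_L_commute[of y x])
  then show ?thesis using q_nonneg[of "x - y"] subspace_diff[OF D(1) assms] by simp
qed

sublocale L: coercive D L \<delta>
  by (rule coercive.intro) (auto simp: D L_linear inner_L_commute \<delta> inner_L_self q_lower)

sublocale M: coercive D M \<delta>
proof (rule coercive.intro)
  show "inner (M x) y = inner (M y) x" for x y
    by (simp add: inner_M inner_L_commute[of x y] inner_commute[of "ell2_nth x []"])
  show "\<delta> * (norm x)\<^sup>2 \<le> inner (M x) x" if "x \<in> D" for x
    using q_lower[OF that] \<delta> by (simp add: inner_M inner_L_self add_increasing2)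
qed (auto simp: D M_linear \<delta>)

interpretation proj: coercive D "\<lambda>x. x" 1
  by (rule coercive_id) (rule D)+

lemma proj_id: "x \<in> D \<Longrightarrow> orthproj D x = x"
  by (rule proj.solve_unique) auto

lemma annihilation_A': "annihilation i (A' x) = A' (annihilation i x)"
proof (rule vector_eq_ldot[THEN iffD1], rule allI)
  show "inner y (annihilation i (A' x)) = inner y (A' (annihilation i x))" for y
    by (simp add: inner_creation_left[symmetric] inner_A[symmetric] A_creation)
qed

text \<open>
  Both \<open>A A\<^sup>*\<close> and the identity are split along the first letter; the creation operators pass through
  \<open>A\<close>, the annihilation operators through \<open>A\<^sup>*\<close>.
\<close>

lemma M_decomposition:
  "M x = (\<Sum>i\<in>UNIV. creation i (L (annihilation i x))) + A (vacuum (ell2_nth (A' x) []))"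
proof -
  have AA: "A (A' x) = A (vacuum (ell2_nth (A' x) []))
      + (\<Sum>i\<in>UNIV. creation i (A (A' (annihilation i x))))"
    by (subst fock_decomposition[of "A' x"])
      (simp add: linear_simps[OF A] linear_sum[OF bounded_linear.linear[OF A]] A_creation
        annihilation_A')
  have "\<delta> *\<^sub>R x = \<delta> *\<^sub>R vacuum (ell2_nth x [])
      + (\<Sum>i\<in>UNIV. creation i (\<delta> *\<^sub>R annihilation i x))"
    by (subst fock_decomposition[of x])
      (simp add: scaleR_add_right scaleR_sum_right linear_simps[OF creation_linear])
  then show ?thesis
    unfolding M_def L_def AA
    by (simp add: linear_simps[OF creation_linear] sum_subtractf)
qed

lemma inner_M_decomposition:
  "inner (M x) x = (norm (ell2_nth (A' x) []))\<^sup>2 + (\<Sum>i\<in>UNIV. q (annihilation i x))"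
  by (simp add: M_decomposition inner_add_left inner_sum_left inner_creation_left inner_L_self
      inner_A inner_vacuum_left power2_norm_eq_inner)

lemma q_le_M: "q x \<le> inner (M x) x"
  using \<delta> by (simp add: inner_M inner_L_self)

text \<open>
  On \<open>D\<close> this is \<open>M\<^sup>-\<^sup>1 L\<close>.  The projection extends it linearly to the whole type, and so makes the
  storage function \<open>q (orthproj D z)\<close> nonnegative everywhere.
\<close>

definition u where "u z = solve_in D M (L (orthproj D z))"

lemma u_mem: "u z \<in> D"
  by (simp add: u_def M.solve_mem)

lemma u_linear: "bounded_linear u"
  unfolding u_def[abs_def]
  by (intro bounded_linear_compose[OF M.bounded_linear_solve]
      bounded_linear_compose[OF L_linear] proj.bounded_linear_solve)

lemma M_u:
  assumes "z \<in> D" shows "M (u z) = L z"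
proof (rule proj.unique)
  show "inner (M (u z)) d = inner (L z) d" if "d \<in> D" for d
    using M.solve_eq[OF that] by (simp add: u_def proj_id assms)
qed (auto simp: M_mem u_mem L_mem assms)

text \<open>
  Formally \<open>t = s\<^sup>* L\<close>; dualizing the recursion for \<open>s\<close> turns it into a system with transitions
  \<open>z \<mapsto> S\<^sub>i\<^sup>* u z\<close> and output \<open>z \<mapsto> (A\<^sup>* u z)\<^sub>0\<close>.
\<close>

definition t where
  "t = observe (\<lambda>i z. annihilation i (u z)) (\<lambda>z. ell2_nth (A' (u z)) [])"

text \<open>
  By \<open>inner_M_decomposition\<close>, output and successor states of \<open>z\<close> have together the energy
  \<open>inner (M (u z)) (u z)\<close>, which for \<open>z \<in> D\<close> equals \<open>inner (L z) (u z)\<close>.  Twice this energy is at most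
  \<open>q z + q (u z)\<close>, and \<open>q (u z)\<close> is at most the energy itself.
\<close>

lemma t_system: "\<exists>K. dissipative_system (\<lambda>i z. annihilation i (u z))
    (\<lambda>z. ell2_nth (A' (u z)) []) (\<lambda>z. q (orthproj D z)) K"
proof -
  have "bounded_linear (\<lambda>z. A' (orthproj D z))"
    by (intro bounded_linear_compose[OF bounded_linear_adjoint[OF A]] proj.bounded_linear_solve)
  then obtain K where K: "\<And>z. norm (A' (orthproj D z)) \<le> norm z * K"
    using bounded_linear.bounded by blast
  show ?thesis
  proof (intro exI dissipative_system.intro)
    show "bounded_linear (\<lambda>z. annihilation i (u z))" for i
      by (rule bounded_linear_compose[OF annihilation_linear u_linear])
    show "bounded_linear (\<lambda>z. ell2_nth (A' (u z)) [])"
      by (intro bounded_linear_compose[OF nth_linear]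
          bounded_linear_compose[OF bounded_linear_adjoint[OF A]] u_linear)
    fix z
    show "0 \<le> q (orthproj D z)" by (rule q_nonneg) (rule proj.solve_mem)
    have "(norm (A' (orthproj D z)))\<^sup>2 \<le> (K * norm z)\<^sup>2"
      using K[of z] by (intro power_mono) (auto simp: mult.commute)
    moreover have "q (orthproj D z) \<le> (norm (A' (orthproj D z)))\<^sup>2"
      using \<delta> by (simp add: q_def)
    ultimately show "q (orthproj D z) \<le> (K * norm z)\<^sup>2" by linarith
    have "inner (M (u z)) (u z) = inner (L (orthproj D z)) (u z)"
      unfolding u_def by (rule M.solve_eq) (rule M.solve_mem)
    moreover have "2 * inner (L (orthproj D z)) (u z) \<le> q (orthproj D z) + q (u z)"
      by (rule q_young) (auto simp: proj.solve_mem u_mem)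
    ultimately have "inner (M (u z)) (u z) \<le> q (orthproj D z)"
      using q_le_M[of "u z"] by linarith
    then show "(norm (ell2_nth (A' (u z)) []))\<^sup>2
        + (\<Sum>i\<in>UNIV. q (orthproj D (annihilation i (u z)))) \<le> q (orthproj D z)"
      by (simp add: inner_M_decomposition proj_id annihilation_mem u_mem)
  qed
qed

lemma t_linear: "bounded_linear t"
  and norm_t: "z \<in> D \<Longrightarrow> (norm (t z))\<^sup>2 \<le> q z"
  and t_decomposition: "t z = vacuum (ell2_nth (A' (u z)) [])
    + (\<Sum>i\<in>UNIV. creation i (t (annihilation i (u z))))"
proof -
  obtain K where "dissipative_system (\<lambda>i z. annihilation i (u z))
    (\<lambda>z. ell2_nth (A' (u z)) []) (\<lambda>z. q (orthproj D z)) K" using t_system by blast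
  then interpret dissipative_system "\<lambda>i z. annihilation i (u z)"
    "\<lambda>z. ell2_nth (A' (u z)) []" "\<lambda>z. q (orthproj D z)" K .
  show "bounded_linear t" unfolding t_def by (rule bounded_linear_observe)
  show "z \<in> D \<Longrightarrow> (norm (t z))\<^sup>2 \<le> q z"
    using norm_observe[of z] by (simp add: t_def proj_id)
  show "t z = vacuum (ell2_nth (A' (u z)) [])
    + (\<Sum>i\<in>UNIV. creation i (t (annihilation i (u z))))"
    unfolding t_def by (rule observe_decomposition)
qed

text \<open>
  The operators \<open>A t\<close> and \<open>L\<close> satisfy the same recursion on \<open>D\<close>, for \<open>L\<close> because of \<open>M u = L\<close>.
\<close>

lemma A_t:
  assumes "z \<in> D" shows "A (t z) = L z"
proof -
  have "A (t z) - L z = 0"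
  proof (rule zero_if_shifted[where E = "\<lambda>z. A (t z) - L z" and Z = D
        and \<sigma> = "\<lambda>i z. annihilation i (u z)"])
    fix z assume z: "z \<in> D"
    have "A (t z) = A (vacuum (ell2_nth (A' (u z)) []))
        + (\<Sum>i\<in>UNIV. creation i (A (t (annihilation i (u z)))))"
      by (subst t_decomposition)
        (simp add: linear_simps[OF A] linear_sum[OF bounded_linear.linear[OF A]] A_creation)
    moreover have "L z = (\<Sum>i\<in>UNIV. creation i (L (annihilation i (u z))))
        + A (vacuum (ell2_nth (A' (u z)) []))"
      by (subst M_u[OF z, symmetric]) (rule M_decomposition)
    ultimately show "A (t z) - L z = (\<Sum>i\<in>UNIV. creation i
        (A (t (annihilation i (u z))) - L (annihilation i (u z))))"
      by (simp add: linear_simps[OF creation_linear] sum_subtractf)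
  qed (auto simp: annihilation_mem u_mem assms)
  then show ?thesis by simp
qed

text \<open>
  On \<open>D\<close>, the relation \<open>A t = L\<close> dualizes to \<open>t\<^sup>* A\<^sup>* = L\<close>; hence \<open>s = L\<^sup>-\<^sup>1 t\<^sup>*\<close> is a left inverse of \<open>A\<^sup>*\<close>.
\<close>

definition s where "s y = solve_in D L (adjoint t y)"

lemma s_mem: "s y \<in> D"
  by (simp add: s_def L.solve_mem)

lemma s_linear: "bounded_linear s"
  unfolding s_def[abs_def]
  by (rule bounded_linear_compose[OF L.bounded_linear_solve bounded_linear_adjoint[OF t_linear]])

lemma inner_L_s: "d \<in> D \<Longrightarrow> inner (L (s y)) d = inner y (t d)"
  using L.solve_eq[of d "adjoint t y"] inner_adjoint[OF t_linear, of d y]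
  by (simp add: s_def inner_commute)

lemma s_A':
  assumes "x \<in> D" shows "s (A' x) = x"
proof (rule L.unique)
  fix d assume d: "d \<in> D"
  have "inner (L (s (A' x))) d = inner (A (t d)) x"
    unfolding inner_L_s[OF d] inner_A by (rule inner_commute)
  then show "inner (L (s (A' x))) d = inner (L x) d"
    by (simp add: A_t d inner_L_commute)
qed (auto simp: s_mem assms)

text \<open>
  The dual of the bound \<open>norm_t\<close>; it makes the storage function of \<open>Q\<close> nonnegative.
\<close>

lemma q_s_le: "q (s y) \<le> (norm y)\<^sup>2"
proof -
  have "q (s y) = inner y (t (s y))"
    using inner_L_s[OF s_mem, of y y] by (simp add: inner_L_self)
  then show ?thesis using two_inner_le[of y "t (s y)"] norm_t[OF s_mem, of y] by linarith
qed

text \<open>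
  With \<open>x = s y\<close>, the energy \<open>inner (M x) x\<close> is the pairing of \<open>y\<close> with \<open>t d\<close>, where \<open>L d = M x\<close> and so
  \<open>u d = x\<close>.  Expanding \<open>t d\<close> by its recursion pairs the data \<open>y\<^sub>0\<close>, \<open>s (S\<^sub>i\<^sup>* y)\<close> with \<open>(A\<^sup>* x)\<^sub>0\<close>,
  \<open>S\<^sub>i\<^sup>* x\<close>, whose energy is again \<open>inner (M x) x\<close>.
\<close>

lemma s_dissipation:
  "q (s y) + \<delta> * (norm (ell2_nth (s y) []))\<^sup>2
    \<le> (norm (ell2_nth y []))\<^sup>2 + (\<Sum>i\<in>UNIV. q (s (annihilation i y)))"
proof -
  define x where "x = s y"
  have x: "x \<in> D" by (simp add: x_def s_mem)
  \<comment> \<open>The test vector for which \<open>u d = x\<close>.\<close>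
  define d where "d = solve_in D L (M x)"
  have d: "d \<in> D" by (simp add: d_def L.solve_mem)
  have Ld: "inner (L d) e = inner (M x) e" if "e \<in> D" for e
    using L.solve_eq[OF that] by (simp add: d_def)
  have "u d = x"
    unfolding u_def proj_id[OF d] by (rule M.solve_unique) (auto simp: x Ld)
  have "2 * inner (M x) x = 2 * inner y (t d)"
    using Ld[OF x] inner_L_s[OF d] by (simp add: x_def inner_L_commute)
  also have "inner y (t d) = inner (ell2_nth y []) (ell2_nth (A' x) [])
      + (\<Sum>i\<in>UNIV. inner (annihilation i y) (t (annihilation i x)))"
    by (subst t_decomposition)
      (simp add: \<open>u d = x\<close> inner_add_right inner_sum_right inner_creation_right
        inner_vacuum_right)
  also have "(\<Sum>i\<in>UNIV. inner (annihilation i y) (t (annihilation i x)))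
      = (\<Sum>i\<in>UNIV. inner (L (s (annihilation i y))) (annihilation i x))"
    by (simp add: inner_L_s annihilation_mem x)
  also have "2 * (inner (ell2_nth y []) (ell2_nth (A' x) []) + \<dots>)
      \<le> ((norm (ell2_nth y []))\<^sup>2 + (norm (ell2_nth (A' x) []))\<^sup>2)
        + (\<Sum>i\<in>UNIV. q (s (annihilation i y)) + q (annihilation i x))"
    unfolding distrib_left sum_distrib_left
    by (intro add_mono sum_mono two_inner_le q_young s_mem annihilation_mem x)
  also have "\<dots> = (norm (ell2_nth y []))\<^sup>2 + (\<Sum>i\<in>UNIV. q (s (annihilation i y)))
      + inner (M x) x"
    by (simp add: inner_M_decomposition sum.distrib)
  finally show ?thesis by (simp add: inner_M inner_L_self x_def power2_norm_eq_inner)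
qed

definition Q where "Q = observe annihilation (\<lambda>y. ell2_nth (s y) [])"

lemma Q_system: "dissipative_system annihilation (\<lambda>y. ell2_nth (s y) [])
    (\<lambda>y. ((norm y)\<^sup>2 - q (s y)) / \<delta>) (1 / sqrt \<delta>)"
proof (rule dissipative_system.intro)
  show "bounded_linear (\<lambda>y. ell2_nth (s y) [])"
    by (rule bounded_linear_compose[OF nth_linear s_linear])
  fix y
  show "0 \<le> ((norm y)\<^sup>2 - q (s y)) / \<delta>" using q_s_le \<delta> by simp
  show "((norm y)\<^sup>2 - q (s y)) / \<delta> \<le> (1 / sqrt \<delta> * norm y)\<^sup>2"
    using q_nonneg[OF s_mem, of y] \<delta> by (simp add: power_mult_distrib power_divide field_simps)
  have "\<delta> * (norm (ell2_nth (s y) []))\<^sup>2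
      + (\<Sum>i\<in>UNIV. (norm (annihilation i y))\<^sup>2 - q (s (annihilation i y))) \<le> (norm y)\<^sup>2 - q (s y)"
    using s_dissipation[of y] norm_fock_decomposition[of y] by (simp add: sum_subtractf)
  then show "(norm (ell2_nth (s y) []))\<^sup>2
      + (\<Sum>i\<in>UNIV. ((norm (annihilation i y))\<^sup>2 - q (s (annihilation i y))) / \<delta>)
      \<le> ((norm y)\<^sup>2 - q (s y)) / \<delta>"
    using divide_right_mono[of _ _ \<delta>] \<delta>
    by (fastforce simp: add_divide_distrib sum_divide_distrib[symmetric])
qed (rule annihilation_linear)

sublocale Q: dissipative_system annihilation "\<lambda>y. ell2_nth (s y) []"
    "\<lambda>y. ((norm y)\<^sup>2 - q (s y)) / \<delta>" "1 / sqrt \<delta>"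
  by (rule Q_system)

lemma Q_linear: "bounded_linear Q"
  unfolding Q_def by (rule Q.bounded_linear_observe)

lemma annihilation_Q: "annihilation i (Q y) = Q (annihilation i y)"
  by (simp add: Q_def Q.annihilation_observe)

lemma Q_A':
  assumes "x \<in> D" shows "Q (A' x) = x"
proof -
  have run: "run annihilation w (A' x) = A' (run annihilation w x)
      \<and> run annihilation w x \<in> D \<and> ell2_nth (run annihilation w x) [] = ell2_nth x w"
    if "x \<in> D" for w x
    using that
    by (induction w arbitrary: x)
      (auto simp: annihilation_A' annihilation_mem annihilation.rep_eq)
  show ?thesis
    by (rule ell2_eqI) (simp add: Q_def Q.nth_observe run[OF assms] s_A')
qed

theorem multi_analytic_right_inverse:
  "\<exists>B. bounded_linear B \<and> (\<forall>i x. B (creation i x) = creation i (B x)) \<and> (\<forall>x\<in>D. A (B x) = x)"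
proof (intro exI conjI allI ballI)
  show "bounded_linear (adjoint Q)" by (rule bounded_linear_adjoint[OF Q_linear])
  show "adjoint Q (creation i x) = creation i (adjoint Q x)" for i x
  proof (rule vector_eq_ldot[THEN iffD1], rule allI)
    show "inner y (adjoint Q (creation i x)) = inner y (creation i (adjoint Q x))" for y
      by (simp add: inner_adjoint[OF Q_linear, symmetric] inner_creation_right annihilation_Q)
  qed
  show "A (adjoint Q x) = x" if x: "x \<in> D" for x
  proof (rule proj.unique)
    show "inner (A (adjoint Q x)) d = inner x d" if "d \<in> D" for d
    proof -
      have "inner (A (adjoint Q x)) d = inner (Q (A' d)) x"
        unfolding inner_A inner_adjoint[OF Q_linear] by (rule inner_commute)
      then show ?thesis by (simp add: Q_A' that inner_commute)
    qed
  qed (auto simp: A_mem x)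
qed

end

section \<open>The quotient by the range of the characteristic operator\<close>

lemma eval_poly_single [simp]: "eval_poly T (Poly_Mapping.single [i] 1) h = T i h"
  by (simp add: eval_poly_def)

text \<open>
  Intertwining the coordinate operators is enough for commuting with all polynomials.
\<close>

lemma intertwiner_eval_poly:
  assumes A: "bounded_clinear A"
    and S: "\<And>x. x \<in> K \<Longrightarrow> A x \<in> K'"
    and T: "\<And>i x. x \<in> K \<Longrightarrow> T i x \<in> K" "\<And>i x. x \<in> K \<Longrightarrow> A (T i x) = T' i (A x)"
    and x: "x \<in> K"
  shows "A (eval_poly T p x) = eval_poly T' p (A x)"
proof -
  interpret bounded_linear A by (rule bounded_clinear_linear[OF A])
  have "eval_word T w x \<in> K \<and> A (eval_word T w x) = eval_word T' w (A x)" for w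
    by (induction w) (auto simp: T x)
  then show ?thesis
    using A by (simp add: eval_poly_def sum bounded_clinear_def)
qed

text \<open>
  Composing the coset map with the inverse of the given unitary leads from cosets back to a map
  between Hilbert spaces.  The factor \<open>2\<close> stands for any constant above \<open>1\<close>: the quotient norm is an
  infimum, and norms of representatives come arbitrarily close to it.
\<close>

lemma characteristic_operator_quotient_map:
  fixes T :: "'m \<Rightarrow> 'h \<Rightarrow> 'h::complex_hilbert_space"
    and \<Theta> :: "('m, 'e::complex_hilbert_space) fock \<Rightarrow> ('m, 's::complex_hilbert_space) fock"
  assumes "characteristic_operator T \<Theta>"
  obtains \<pi> where "bounded_clinear \<pi>" "\<And>i y. \<pi> (creation i y) = T i (\<pi> y)"
    "\<And>y. \<pi> y = 0 \<longleftrightarrow> y \<in> range \<Theta>"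
    "\<And>h. \<exists>y. \<pi> y = h \<and> norm y \<le> 2 * norm h"
proof -
  define M where "M = range \<Theta>"
  define Q where "Q = quotient_module (hilbert_module creation) M"
  define cos where "cos x = {x + y |y. y \<in> M}" for x
  have \<Theta>: "bounded_clinear \<Theta>" "\<And>i x. \<Theta> (creation i x) = creation i (\<Theta> x)"
    using assms by (auto simp: characteristic_operator_def multi_analytic_def fun_eq_iff)
  interpret \<Theta>: bounded_linear \<Theta> by (rule bounded_clinear_linear[OF \<Theta>(1)])
  have M_add: "x + y \<in> M" if "x \<in> M" "y \<in> M" for x y
    using that by (auto simp: M_def \<Theta>.add[symmetric])
  have M_scale: "c *\<^sub>C x \<in> M" if "x \<in> M" for c x
  proof -
    obtain g where "x = \<Theta> g" using \<open>x \<in> M\<close> by (auto simp: M_def)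
    then have "c *\<^sub>C x = \<Theta> (c *\<^sub>C g)" using \<Theta>(1) by (simp add: bounded_clinear_def)
    then show ?thesis by (simp add: M_def)
  qed
  have M_0: "0 \<in> M" using M_def \<Theta>.zero by (metis rangeI)
  have M_minus: "- x \<in> M" if "x \<in> M" for x
    using M_scale[OF that, of "-1"] by (simp add: scaleC_minus_one)
  have M_act: "eval_poly creation p x \<in> M" if x: "x \<in> M" for p x
  proof -
    obtain g where g: "x = \<Theta> g" using \<open>x \<in> M\<close> by (auto simp: M_def)
    have "\<Theta> (eval_poly creation p g) = eval_poly creation p (\<Theta> g)"
      by (rule intertwiner_eval_poly[where K = UNIV and K' = UNIV]) (auto simp: \<Theta>)
    then show ?thesis unfolding M_def g by (metis rangeI)
  qed
  have cos_mem: "z \<in> cos x \<longleftrightarrow> z - x \<in> M" for z x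
    unfolding cos_def by (auto intro!: exI[of _ "z - x"])
  have cos_eq: "cos x = cos y \<longleftrightarrow> x - y \<in> M" for x y
  proof
    assume "cos x = cos y"
    then have "x \<in> cos y" using cos_mem[of x x] M_0 by simp
    then show "x - y \<in> M" by (simp add: cos_mem)
  next
    assume xy: "x - y \<in> M"
    have "z - x \<in> M \<longleftrightarrow> z - y \<in> M" for z
      using M_add[OF _ xy, of "z - x"] M_add[OF _ M_minus[OF xy], of "z - y"]
      by (auto simp: algebra_simps)
    then show "cos x = cos y" by (auto simp: cos_mem)
  qed
  have cos_add: "madd Q (cos x) (cos y) = cos (x + y)" for x y
  proof (rule set_eqI)
    fix z
    have "z \<in> madd Q (cos x) (cos y) \<longleftrightarrow>
        (\<exists>a b c. z = a + b + c \<and> a \<in> cos x \<and> b \<in> cos y \<and> c \<in> M)"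
      by (auto simp: Q_def quotient_module_def hilbert_submodule_def)
    also have "\<dots> \<longleftrightarrow> z \<in> cos (x + y)"
    proof
      assume "\<exists>a b c. z = a + b + c \<and> a \<in> cos x \<and> b \<in> cos y \<and> c \<in> M"
      then obtain a b c where *: "z = a + b + c" "a - x \<in> M" "b - y \<in> M" "c \<in> M"
        by (auto simp: cos_mem)
      have "z - (x + y) = (a - x) + (b - y) + c" by (simp add: *)
      then show "z \<in> cos (x + y)" unfolding cos_mem by (simp only: M_add *)
    next
      assume "z \<in> cos (x + y)"
      then show "\<exists>a b c. z = a + b + c \<and> a \<in> cos x \<and> b \<in> cos y \<and> c \<in> M"
        by (intro exI[of _ x] exI[of _ y] exI[of _ "z - (x + y)"]) (simp add: cos_mem M_0)
    qed
    finally show "z \<in> madd Q (cos x) (cos y) \<longleftrightarrow> z \<in> cos (x + y)" .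
  qed
  have coset_map: "{f a + b |a b. a \<in> cos x \<and> b \<in> M} = cos (f x)"
    if "\<And>a b. f (a + b) = f a + f b" "\<And>m. m \<in> M \<Longrightarrow> f m \<in> M" for f x
  proof (rule set_eqI)
    fix z
    show "z \<in> {f a + b |a b. a \<in> cos x \<and> b \<in> M} \<longleftrightarrow> z \<in> cos (f x)"
    proof
      assume "z \<in> {f a + b |a b. a \<in> cos x \<and> b \<in> M}"
      then obtain m b where "z = f (x + m) + b" "m \<in> M" "b \<in> M" by (auto simp: cos_def)
      then show "z \<in> cos (f x)" by (simp add: cos_mem that M_add)
    next
      assume "z \<in> cos (f x)"
      then have "z = f x + (z - f x)" "x \<in> cos x" "z - f x \<in> M"
        by (simp_all add: cos_mem M_0)
      then show "z \<in> {f a + b |a b. a \<in> cos x \<and> b \<in> M}" by blast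
    qed
  qed
  have cos_scale: "mscale Q c (cos x) = cos (c *\<^sub>C x)" for c x
    using coset_map[of "(*\<^sub>C) c" x]
    by (simp add: Q_def quotient_module_def hilbert_submodule_def scaleC_add_right M_scale)
  have eval_word_add: "eval_word creation w (a + b) = eval_word creation w a + eval_word creation w b"
    for w :: "'m list" and a b :: "('m, 's) fock"
    by (induction w)
      (simp_all add: linear_simps[OF bounded_clinear_linear[OF bounded_clinear_creation]])
  have eval_poly_add: "eval_poly creation p (a + b) = eval_poly creation p a + eval_poly creation p b"
    for p and a b :: "('m, 's) fock"
    by (simp add: eval_poly_def eval_word_add scaleC_add_right sum.distrib)
  have cos_act: "mact Q p (cos x) = cos (eval_poly creation p x)" for p x
    using coset_map[of "eval_poly creation p" x]
    by (simp add: Q_def quotient_module_def hilbert_submodule_def M_act eval_poly_add)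
  have cos_norm: "mnorm Q X = (INF z\<in>X. norm z)" for X
    by (simp add: Q_def quotient_module_def hilbert_submodule_def)
  have carrier: "mcarrier Q = range cos"
    by (auto simp: Q_def quotient_module_def hilbert_submodule_def cos_def)
  have "isometrically_isomorphic (hilbert_module T) Q"
    using assms by (simp add: characteristic_operator_def Q_def M_def)
  moreover have "mcarrier (hilbert_module T) = UNIV" "mnorm (hilbert_module T) = norm"
    by (simp_all add: hilbert_submodule_def)
  ultimately obtain U where "module_map (hilbert_module T) Q U"
    and U_range: "range U = range cos" and U_norm: "\<And>h. mnorm Q (U h) = norm h"
    by (auto simp: isometrically_isomorphic_def carrier)
  then have U_add: "\<And>x y. U (x + y) = madd Q (U x) (U y)"
    and U_scale: "\<And>c x. U (c *\<^sub>C x) = mscale Q c (U x)"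
    and U_act: "\<And>p x. U (eval_poly T p x) = mact Q p (U x)"
    by (auto simp: module_map_def bounded_operator_def hilbert_submodule_def)
  have cos_norm_le: "mnorm Q (cos x) \<le> norm x" for x
    unfolding cos_norm by (rule cINF_lower) (auto simp: cos_mem M_0 intro!: bdd_belowI2[where m = 0])
  have U_inj: "h = h'" if "U h = U h'" for h h'
  proof -
    obtain y where y: "U h' = cos y" using U_range by blast
    have "U (h + (- 1) *\<^sub>C h') = cos (y + (- 1) *\<^sub>C y)"
      by (simp only: U_add U_scale that y cos_add cos_scale)
    then have "norm (h - h') \<le> norm (0 :: ('m, 's) fock)"
      using U_norm[of "h - h'"] cos_norm_le[of 0] by (simp add: scaleC_minus_one)
    then show ?thesis by simp
  qed
  have "\<exists>h. U h = cos y" for y using U_range by (metis rangeE rangeI)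
  then obtain \<pi> where \<pi>: "\<And>y. U (\<pi> y) = cos y" by metis
  have \<pi>_norm: "norm (\<pi> y) \<le> norm y" for y
    using cos_norm_le[of y] U_norm[of "\<pi> y"] by (simp add: \<pi>)
  have \<pi>_add: "\<pi> (x + y) = \<pi> x + \<pi> y" for x y
    by (rule U_inj) (simp add: \<pi> U_add cos_add)
  have \<pi>_scale: "\<pi> (c *\<^sub>C x) = c *\<^sub>C \<pi> x" for c x
    by (rule U_inj) (simp add: \<pi> U_scale cos_scale)
  have "U 0 = cos 0"
    using U_scale[of 0 "\<pi> 0"] cos_scale[of 0 0] by (simp add: \<pi>)
  show thesis
  proof (rule that)
    show "bounded_clinear \<pi>"
      unfolding bounded_clinear_def
      by (intro conjI allI bounded_linear_intro[where K = 1])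
        (simp_all add: \<pi>_add \<pi>_scale \<pi>_norm scaleR_scaleC)
    show "\<pi> (creation i y) = T i (\<pi> y)" for i y
    proof (rule U_inj)
      show "U (\<pi> (creation i y)) = U (T i (\<pi> y))"
        using U_act[of "Poly_Mapping.single [i] 1" "\<pi> y"]
          cos_act[of "Poly_Mapping.single [i] 1" y] by (simp add: \<pi>)
    qed
    show "\<pi> y = 0 \<longleftrightarrow> y \<in> range \<Theta>" for y
      using U_inj[of "\<pi> y" 0] cos_eq[of y 0] \<open>U 0 = cos 0\<close> \<pi>[of y] unfolding M_def by auto
    show "\<exists>y. \<pi> y = h \<and> norm y \<le> 2 * norm h" for h
    proof (cases "h = 0")
      case True
      then show ?thesis
        using \<pi>_scale[of 0 0] by (intro exI[of _ 0]) simp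
    next
      case False
      obtain x where x: "U h = cos x" using U_range by blast
      have "(INF z\<in>cos x. norm z) < 2 * norm h"
        using U_norm[of h] False by (simp add: x cos_norm)
      then obtain y where y: "y \<in> cos x" "norm y < 2 * norm h"
        using cInf_lessD[of "norm ` cos x" "2 * norm h"] cos_mem[of x x] M_0 by auto
      have "\<pi> y = h" by (rule U_inj) (use y in \<open>simp add: \<pi> x cos_eq cos_mem\<close>)
      then show ?thesis using y by auto
    qed
  qed
qed

section \<open>The Wold decomposition of an invariant subspace\<close>

text \<open>
  The creation operators restricted to \<open>N\<close> are isometries with orthogonal ranges, whose adjoints are
  \<open>\<tau> i = P\<^sub>N S\<^sub>i\<^sup>*\<close>.  The wandering subspace \<open>W\<close> is the orthogonal complement in \<open>N\<close> of their ranges, and \<open>c\<close>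
  is the projection onto it.  The coordinates \<open>C\<close> of a vector with respect to
  the subspaces \<open>S\<^sub>w W\<close> are the outputs of the system \<open>(\<tau>, c)\<close>, with storage \<open>(norm (P\<^sub>N x))\<^sup>2\<close>.  Their adjoint
  \<open>U\<close> is the synthesis operator.  Both \<open>U C = id\<close> and \<open>C U = id\<close> follow from \<open>zero_if_shifted\<close>; purity
  enters there, through the fact that every vector of a Fock space is determined by its coefficients.
\<close>

theorem invariant_subspace_Wold:
  fixes N :: "('m::finite, 's::complex_hilbert_space) fock set"
  assumes N: "closed_csubspace N" and creation_N: "\<forall>i. \<forall>x\<in>N. creation i x \<in> N"
  shows "\<exists>W (C :: ('m, 's) fock \<Rightarrow> ('m, ('m, 's) fock) fock) U.
    closed_csubspace W \<and> W \<subseteq> N \<and> bounded_clinear C \<and> bounded_clinear U \<and>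
    (\<forall>x\<in>N. C x \<in> fock_over W \<and> U (C x) = x) \<and>
    (\<forall>f\<in>fock_over W. U f \<in> N \<and> C (U f) = f) \<and>
    (\<forall>i. \<forall>x\<in>N. C (creation i x) = creation i (C x))"
proof -
  note cl = bounded_clinear_linear
  have invariant: "creation i x \<in> N" if "x \<in> N" for i x using creation_N that by blast
  note sub = closed_csubspace_subspace[OF N]
  interpret P: coercive N "\<lambda>x. x" 1 by (rule coercive_id) (rule sub)+
  define P where "P = orthproj N"
  have P_mem: "P x \<in> N" and inner_P: "n \<in> N \<Longrightarrow> inner (P x) n = inner x n" for x n
    by (simp_all add: P_def P.solve)
  have P_unique: "P x = y" if "y \<in> N" "\<And>n. n \<in> N \<Longrightarrow> inner y n = inner x n" for x y
    unfolding P_def using that by (rule P.solve_unique)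
  have P_id: "P x = x" if "x \<in> N" for x using that by (intro P_unique) auto
  have P_cl: "bounded_clinear P" unfolding P_def by (rule bounded_clinear_orthproj[OF N])
  define \<tau> where "\<tau> i x = P (annihilation i x)" for i x
  define c where "c x = P x - (\<Sum>i\<in>UNIV. creation i (\<tau> i x))" for x
  define W where "W = {x \<in> N. \<forall>i. \<tau> i x = 0}"
  have \<tau>_cl: "bounded_clinear (\<tau> i)" for i
    unfolding \<tau>_def[abs_def] by (intro bounded_clinear_compose[OF P_cl] bounded_clinear_annihilation)
  have c_cl: "bounded_clinear c"
    unfolding c_def[abs_def]
    by (intro bounded_clinear_diff P_cl bounded_clinear_sum
        bounded_clinear_compose[OF bounded_clinear_creation] \<tau>_cl)
  have \<tau>_mem: "\<tau> i x \<in> N" for i x by (simp add: \<tau>_def P_mem)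
  have inner_\<tau>: "inner (\<tau> i x) n = inner x (creation i n)" if "n \<in> N" for i x n
    by (simp add: \<tau>_def inner_P that inner_creation_right)
  have \<tau>_P: "\<tau> i (P x) = \<tau> i x" for i x
    unfolding \<tau>_def[of i "P x"]
    by (rule P_unique) (simp_all add: \<tau>_mem inner_\<tau> inner_creation_right[symmetric] inner_P invariant)
  have \<tau>_creation: "\<tau> j (creation i x) = (if i = j then x else 0)" if "x \<in> N" for i j x
    using linear_simps(3)[OF cl[OF P_cl]] by (simp add: \<tau>_def annihilation_creation P_id that)
  have row_mem: "(\<Sum>i\<in>UNIV. creation i (\<tau> i x)) \<in> N" for x
    by (intro subspace_sum sub invariant \<tau>_mem)
  have c_W: "c x \<in> W" for x
  proof -
    have "\<tau> j (\<Sum>i\<in>UNIV. creation i (\<tau> i x)) = \<tau> j x" for j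
      by (simp add: linear_sum[OF bounded_linear.linear[OF cl[OF \<tau>_cl]]] \<tau>_creation \<tau>_mem)
    then show ?thesis
      by (auto simp: W_def c_def \<tau>_P linear_simps[OF cl[OF \<tau>_cl]]
          intro!: subspace_diff sub(1) P_mem row_mem)
  qed
  have inner_W: "inner w (creation i n) = 0" if "w \<in> W" "n \<in> N" for w i n
    using inner_\<tau>[OF that(2), of i w] that(1) by (simp add: W_def)
  have P_split: "P x = c x + (\<Sum>i\<in>UNIV. creation i (\<tau> i x))" for x
    by (simp add: c_def)
  have energy: "(norm (c x))\<^sup>2 + (\<Sum>i\<in>UNIV. (norm (\<tau> i x))\<^sup>2) = inner x (P x)" for x
  proof -
    have "inner x (P x) = inner (P x) (P x)" by (simp add: inner_P P_mem)
    also have "\<dots> = inner (c x) (c x) + 2 * inner (c x) (\<Sum>i\<in>UNIV. creation i (\<tau> i x))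
        + inner (\<Sum>i\<in>UNIV. creation i (\<tau> i x)) (\<Sum>i\<in>UNIV. creation i (\<tau> i x))"
      unfolding P_split by (simp add: inner_add_left inner_add_right inner_commute)
    also have "inner (c x) (\<Sum>i\<in>UNIV. creation i (\<tau> i x)) = 0"
      by (simp add: inner_sum_right inner_W c_W \<tau>_mem)
    also have "inner (\<Sum>i\<in>UNIV. creation i (\<tau> i x)) (\<Sum>i\<in>UNIV. creation i (\<tau> i x))
        = (\<Sum>i\<in>UNIV. inner (\<tau> i x) (\<tau> i x))"
      by (simp add: inner_sum_left inner_creation_left ell2_nth_sum
          linear_sum[OF bounded_linear.linear[OF cl[OF bounded_clinear_annihilation]]]
          annihilation_creation)
    finally show ?thesis by (simp add: power2_norm_eq_inner)
  qed
  have inner_P_le: "inner x (P x) \<le> (norm x)\<^sup>2" and inner_P_ge: "0 \<le> inner x (P x)" for x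
  proof -
    have "inner x (P x) = inner (P x) (P x)" by (simp add: inner_P P_mem)
    then show "0 \<le> inner x (P x)" by simp
    have "0 \<le> inner (x - P x) (x - P x)" by simp
    also have "\<dots> = inner x x - inner x (P x)"
      by (simp add: inner_diff_left inner_diff_right inner_P P_mem inner_commute[of "P x" x])
    finally show "inner x (P x) \<le> (norm x)\<^sup>2" by (simp add: power2_norm_eq_inner)
  qed
  interpret C: dissipative_system \<tau> c "\<lambda>x. inner x (P x)" 1
  proof (rule dissipative_system.intro)
    fix x
    show "(norm (c x))\<^sup>2 + (\<Sum>i\<in>UNIV. inner (\<tau> i x) (P (\<tau> i x))) \<le> inner x (P x)"
      using energy[of x] by (simp add: P_id \<tau>_mem power2_norm_eq_inner)
  qed (auto simp: cl[OF \<tau>_cl] cl[OF c_cl] inner_P_le inner_P_ge)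
  define C where "C = observe \<tau> c"
  define U where "U = adjoint C"
  have C_cl: "bounded_clinear C"
    unfolding C_def by (rule bounded_clinear_observe[OF C.dissipative_system_axioms \<tau>_cl c_cl])
  have U_cl: "bounded_clinear U" unfolding U_def by (rule bounded_clinear_adjoint[OF C_cl])
  have inner_U: "inner (U f) x = inner f (C x)" for f x
    using inner_adjoint[OF cl[OF C_cl], of x f] by (simp add: U_def inner_commute)
  have C_split: "C x = vacuum (c x) + (\<Sum>i\<in>UNIV. creation i (C (\<tau> i x)))" for x
    unfolding C_def by (rule C.observe_decomposition)
  have C_P: "C (P x) = C x" for x
    using C_split[of "P x"] C_split[of x] by (simp add: \<tau>_P c_def P_id P_mem)
  have U_mem: "U f \<in> N" for f
  proof -
    have "P (U f) = U f"
    proof (rule vector_eq_rdot[THEN iffD1], rule allI)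
      fix x
      have "inner (P (U f)) x = inner (P (U f)) (P x)"
        using inner_P[OF P_mem, of x "U f"] by (simp add: inner_commute)
      then show "inner (P (U f)) x = inner (U f) x"
        by (simp add: inner_P P_mem inner_U C_P)
    qed
    then show ?thesis using P_mem by metis
  qed
  have U_vacuum: "U (vacuum w) = w" if w: "w \<in> W" for w
  proof (rule P.unique)
    fix n assume n: "n \<in> N"
    have "inner (U (vacuum w)) n = inner w (c n)"
      by (simp add: inner_U inner_vacuum_left C_def C.nth_observe)
    then show "inner (U (vacuum w)) n = inner w n"
      by (simp add: c_def P_id n inner_diff_right inner_sum_right inner_W w \<tau>_mem)
  qed (use w U_mem in \<open>auto simp: W_def\<close>)
  have U_creation: "U (creation i f) = creation i (U f)" for i f
  proof (rule P.unique)
    fix n assume n: "n \<in> N"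
    have "inner (U (creation i f)) n = inner (U f) (\<tau> i n)"
      by (simp add: inner_U inner_creation_left C_def C.annihilation_observe)
    also have "\<dots> = inner (creation i (U f)) n"
      using inner_\<tau>[OF U_mem, of i n f] by (simp add: inner_commute)
    finally show "inner (U (creation i f)) n = inner (creation i (U f)) n" .
  qed (simp_all add: U_mem invariant)
  have C_creation: "C (creation i x) = creation i (C x)" if x: "x \<in> N" for i x
  proof -
    have "c (creation i x) = 0"
      by (simp add: c_def P_id invariant x \<tau>_creation if_distrib[of "creation _"]
          linear_simps(3)[OF cl[OF bounded_clinear_creation]] cong: if_cong)
    then show ?thesis
      by (subst C_split)
        (simp add: \<tau>_creation x linear_simps(3)[OF cl[OF C_cl]] if_distrib[of C]
          if_distrib[of "creation _"] linear_simps(3)[OF cl[OF bounded_clinear_creation]]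
          linear_simps(3)[OF cl[OF bounded_clinear_vacuum]] cong: if_cong)
  qed
  have C_W: "C w = vacuum w" if "w \<in> W" for w
  proof -
    have "w \<in> N" "\<And>i. \<tau> i w = 0" using that by (auto simp: W_def)
    then show ?thesis
      by (subst C_split)
        (simp add: c_def P_id linear_simps(3)[OF cl[OF C_cl]]
          linear_simps(3)[OF cl[OF bounded_clinear_creation]])
  qed
  have W: "closed_csubspace W"
  proof -
    have "W = N \<inter> (\<Inter>i. \<tau> i -` {0})" by (auto simp: W_def)
    moreover have "closed (\<tau> i -` {0})" for i
      by (rule closed_vimage[OF closed_singleton])
        (use linear_continuous_on[OF cl[OF \<tau>_cl]] in auto)
    ultimately have "closed W" using sub(2) by auto
    then show ?thesis
      using N \<tau>_cl linear_simps[OF cl[OF \<tau>_cl]]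
      by (auto simp: closed_csubspace_def W_def bounded_clinear_def)
  qed
  show ?thesis
  proof (intro exI conjI ballI allI)
    show "closed_csubspace W" "bounded_clinear C" "bounded_clinear U" by (fact W C_cl U_cl)+
    show "W \<subseteq> N" by (auto simp: W_def)
    show "C x \<in> fock_over W" for x
      by (simp add: fock_over_def C_def C.nth_observe c_W)
    show "U f \<in> N" for f by (rule U_mem)
    show "C (creation i x) = creation i (C x)" if "x \<in> N" for i x
      using that by (rule C_creation)
    show "U (C x) = x" if x: "x \<in> N" for x
    proof -
      have "U (C x) - x = 0"
      proof (rule zero_if_shifted[where E = "\<lambda>x. U (C x) - x" and Z = N and \<sigma> = \<tau>])
        fix x assume x: "x \<in> N"
        have "U (C x) = c x + (\<Sum>i\<in>UNIV. creation i (U (C (\<tau> i x))))"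
          by (subst C_split)
            (simp add: linear_simps[OF cl[OF U_cl]]
              linear_sum[OF bounded_linear.linear[OF cl[OF U_cl]]] U_creation U_vacuum c_W)
        moreover have "c x + (\<Sum>i\<in>UNIV. creation i (\<tau> i x)) = x"
          using P_split[of x] by (simp add: P_id x)
        ultimately show "U (C x) - x = (\<Sum>i\<in>UNIV. creation i (U (C (\<tau> i x)) - \<tau> i x))"
          by (simp add: linear_simps[OF cl[OF bounded_clinear_creation]] sum_subtractf
              algebra_simps)
      qed (auto simp: \<tau>_mem x)
      then show ?thesis by simp
    qed
    show "C (U f) = f" if f: "f \<in> fock_over W" for f
    proof -
      have "C (U f) - f = 0"
      proof (rule zero_if_shifted[where E = "\<lambda>f. C (U f) - f" and Z = "fock_over W"
            and \<sigma> = annihilation])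
        fix f :: "('m, ('m, 's) fock) fock" assume f: "f \<in> fock_over W"
        then have f0: "ell2_nth f [] \<in> W" by (simp add: fock_over_def)
        have "C (U f) = C (U (vacuum (ell2_nth f []) + (\<Sum>i\<in>UNIV. creation i (annihilation i f))))"
          by (subst fock_decomposition) simp
        also have "\<dots> = vacuum (ell2_nth f [])
            + (\<Sum>i\<in>UNIV. creation i (C (U (annihilation i f))))"
          by (simp add: linear_simps[OF cl[OF U_cl]] linear_simps[OF cl[OF C_cl]]
              linear_sum[OF bounded_linear.linear[OF cl[OF U_cl]]]
              linear_sum[OF bounded_linear.linear[OF cl[OF C_cl]]]
              U_creation U_vacuum C_W C_creation U_mem f0)
        finally show "C (U f) - f
            = (\<Sum>i\<in>UNIV. creation i (C (U (annihilation i f)) - annihilation i f))"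
          using fock_decomposition[of f, symmetric]
          by (simp add: linear_simps[OF cl[OF bounded_clinear_creation]] sum_subtractf
              algebra_simps)
      qed (use f in \<open>auto simp: fock_over_def annihilation.rep_eq\<close>)
      then show ?thesis by simp
    qed
  qed
qed

section \<open>Similarity to a free module\<close>

text \<open>
  The operator \<open>I \<otimes> A\<close>; the default value for unbounded \<open>A\<close> keeps the result square-summable.
\<close>

lift_definition ell2_map ::
    "('e \<Rightarrow> 'g) \<Rightarrow> ('i, 'e::complex_hilbert_space) ell2 \<Rightarrow> ('i, 'g::complex_hilbert_space) ell2"
  is "\<lambda>A f. if bounded_clinear A then (\<lambda>i. A (f i)) else (\<lambda>_. 0)"
proof -
  fix A :: "'e \<Rightarrow> 'g" and f :: "'i \<Rightarrow> 'e"
  assume f: "(\<lambda>i. (norm (f i))\<^sup>2) summable_on UNIV"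
  have "(\<lambda>i. (norm (A (f i)))\<^sup>2) summable_on UNIV" if A: "bounded_clinear A"
  proof -
    obtain K where K: "\<And>x. norm (A x) \<le> norm x * K"
      using bounded_linear.bounded[OF bounded_clinear_linear[OF A]] by blast
    show ?thesis
    proof (rule summable_on_comparison_test)
      show "(\<lambda>i. (norm (f i))\<^sup>2 * K\<^sup>2) summable_on UNIV"
        using f by (rule summable_on_cmult_left)
      show "(norm (A (f i)))\<^sup>2 \<le> (norm (f i))\<^sup>2 * K\<^sup>2" for i
        using power_mono[OF K[of "f i"], of 2] by (simp add: power_mult_distrib)
    qed simp
  qed
  then show "(\<lambda>i. (norm ((if bounded_clinear A then (\<lambda>i. A (f i)) else (\<lambda>_. 0)) i))\<^sup>2)
      summable_on UNIV"
    by simp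
qed

context
  fixes A :: "'e::complex_hilbert_space \<Rightarrow> 'g::complex_hilbert_space"
  assumes A: "bounded_clinear A"
begin

lemma nth_ell2_map: "ell2_nth (ell2_map A f) i = A (ell2_nth f i)"
  by (simp add: ell2_map.rep_eq A)

lemma bounded_clinear_ell2_map: "bounded_clinear (ell2_map A :: ('i, 'e) ell2 \<Rightarrow> _)"
proof -
  interpret A: bounded_linear A by (rule bounded_clinear_linear[OF A])
  obtain K where K: "0 < K" "\<And>x. norm (A x) \<le> norm x * K" using A.pos_bounded by blast
  show ?thesis
    unfolding bounded_clinear_def
  proof (intro conjI allI bounded_linear_intro[where K = K])
    fix f g :: "('i, 'e) ell2" and r :: real and c :: complex
    show "ell2_map A (f + g) = ell2_map A f + ell2_map A g"
      by (rule ell2_eqI) (simp add: nth_ell2_map plus_ell2.rep_eq A.add)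
    show "ell2_map A (r *\<^sub>R f) = r *\<^sub>R ell2_map A f"
      by (rule ell2_eqI) (simp add: nth_ell2_map scaleR_ell2.rep_eq A.scaleR)
    show "ell2_map A (c *\<^sub>C f) = c *\<^sub>C ell2_map A f"
      using A by (intro ell2_eqI) (simp add: nth_ell2_map scaleC_ell2.rep_eq bounded_clinear_def)
    show "norm (ell2_map A f) \<le> norm f * K"
    proof (rule power2_le_imp_le)
      have "(norm (ell2_map A f))\<^sup>2 \<le> (\<Sum>\<^sub>\<infinity>i. (norm (ell2_nth f i))\<^sup>2 * K\<^sup>2)"
        unfolding norm_ell2_square
      proof (rule infsum_mono)
        show "(\<lambda>i. (norm (ell2_nth f i))\<^sup>2 * K\<^sup>2) summable_on UNIV"
          by (rule summable_on_cmult_left[OF ell2_summable])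
        show "(norm (ell2_nth (ell2_map A f) i))\<^sup>2 \<le> (norm (ell2_nth f i))\<^sup>2 * K\<^sup>2" for i
          using power_mono[OF K(2)[of "ell2_nth f i"], of 2]
          by (simp add: power_mult_distrib nth_ell2_map)
      qed (rule ell2_summable)
      also have "\<dots> = (norm f * K)\<^sup>2"
        by (simp add: infsum_cmult_left' power_mult_distrib norm_ell2_square)
      finally show "(norm (ell2_map A f))\<^sup>2 \<le> (norm f * K)\<^sup>2" .
    qed (use K in simp)
  qed
qed

lemma ell2_map_creation: "ell2_map A (creation i f) = creation i (ell2_map A f)"
  by (rule ell2_eqI)
    (auto simp: nth_ell2_map creation.rep_eq linear_simps(3)[OF bounded_clinear_linear[OF A]]
      split: list.splits)

end

lemma bounded_operator_hilbert_submodule: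
  assumes "bounded_clinear X" "\<And>x. x \<in> K \<Longrightarrow> X x \<in> K'"
  shows "bounded_operator (hilbert_submodule K T) (hilbert_submodule K' T') X"
proof -
  interpret X: bounded_linear X by (rule bounded_clinear_linear[OF assms(1)])
  obtain C where "\<And>x. norm (X x) \<le> norm x * C" using X.bounded by blast
  then show ?thesis
    using assms
    by (auto simp: bounded_operator_def hilbert_submodule_def X.add bounded_clinear_def
        intro!: exI[of _ C]) (simp add: mult.commute)
qed

text \<open>
  A left inverse \<open>\<Psi>\<close> makes \<open>E = I - \<Theta> \<Psi>\<close> an idempotent that commutes with the creation operators and
  has the range of \<open>\<Theta>\<close> as its kernel.  Hence the quotient is similar, by \<open>\<pi>\<close> and its inverse \<open>\<rho>\<close>, to the
  invariant subspace \<open>N = ker \<Psi>\<close>, which is a free module over its wandering subspace \<open>W\<close>.  Since only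
  similarity is claimed, the image of \<open>W\<close> in the original space may serve as \<open>F\<close>.
\<close>

lemma left_invertible_imp_similar:
  fixes T :: "'m::finite \<Rightarrow> 'h \<Rightarrow> 'h::complex_hilbert_space"
    and \<Theta> :: "('m, 'e::complex_hilbert_space) fock \<Rightarrow> ('m, 's::complex_hilbert_space) fock"
  assumes char: "characteristic_operator T \<Theta>" and left: "left_invertible \<Theta>"
  shows "\<exists>F :: 'h set. closed_csubspace F \<and>
      similar (hilbert_module T) (hilbert_submodule (fock_over F) creation)"
proof -
  note cl = bounded_clinear_linear
  obtain \<pi> where \<pi>: "bounded_clinear \<pi>" "\<And>i y. \<pi> (creation i y) = T i (\<pi> y)"
    and ker: "\<And>y. \<pi> y = 0 \<longleftrightarrow> y \<in> range \<Theta>"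
    and lift: "\<And>h. \<exists>y. \<pi> y = h \<and> norm y \<le> 2 * norm h"
    using characteristic_operator_quotient_map[OF char] by metis
  obtain \<Psi> where \<Psi>: "bounded_clinear \<Psi>" "\<And>i y. \<Psi> (creation i y) = creation i (\<Psi> y)"
    and \<Psi>\<Theta>: "\<And>g. \<Psi> (\<Theta> g) = g"
    using left by (auto simp: left_invertible_def multi_analytic_def fun_eq_iff)
  have \<Theta>: "bounded_clinear \<Theta>" "\<And>i x. \<Theta> (creation i x) = creation i (\<Theta> x)"
    using char by (auto simp: characteristic_operator_def multi_analytic_def fun_eq_iff)
  define N where "N = {y. \<Psi> y = 0}"
  define E where "E y = y - \<Theta> (\<Psi> y)" for y
  have id_cl: "bounded_clinear (\<lambda>y. y :: ('m, 's) fock)"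
    by (simp add: bounded_clinear_def bounded_linear_ident)
  have E_cl: "bounded_clinear E"
    unfolding E_def[abs_def]
    by (intro bounded_clinear_diff id_cl bounded_clinear_compose[OF \<Theta>(1) \<Psi>(1)])
  have E_mem: "E y \<in> N" for y
    by (simp add: E_def N_def linear_simps[OF cl[OF \<Psi>(1)]] \<Psi>\<Theta>)
  have E_id: "E n = n" if "n \<in> N" for n
    using that by (simp add: E_def N_def linear_simps[OF cl[OF \<Theta>(1)]])
  have \<pi>_E: "\<pi> (E y) = \<pi> y" for y
    using ker[of "\<Theta> (\<Psi> y)"] by (simp add: E_def linear_simps[OF cl[OF \<pi>(1)]])
  have E_creation: "E (creation i y) = creation i (E y)" for i y
    by (simp add: E_def \<Psi> \<Theta> linear_simps[OF cl[OF bounded_clinear_creation]])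
  have E_\<Theta>: "E (\<Theta> g) = 0" for g by (simp add: E_def \<Psi>\<Theta>)
  have E_ker: "E y = E y'" if "\<pi> y = \<pi> y'" for y y'
  proof -
    have "y - y' \<in> range \<Theta>"
      using ker[of "y - y'"] that by (simp add: linear_simps[OF cl[OF \<pi>(1)]])
    then obtain g where "y - y' = \<Theta> g" by auto
    then have "E (y - y') = 0" by (simp add: E_\<Theta>)
    then show ?thesis by (simp add: linear_simps[OF cl[OF E_cl]])
  qed
  obtain l where l: "\<And>h. \<pi> (l h) = h" "\<And>h. norm (l h) \<le> 2 * norm h"
    using lift by metis
  define \<rho> where "\<rho> h = E (l h)" for h
  have \<rho>_\<pi>: "\<rho> (\<pi> y) = E y" for y unfolding \<rho>_def by (rule E_ker) (rule l)
  have \<pi>_\<rho>: "\<pi> (\<rho> h) = h" for h by (simp add: \<rho>_def \<pi>_E l)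
  have \<rho>_cl: "bounded_clinear \<rho>"
  proof -
    obtain K where K: "0 < K" "\<And>y. norm (E y) \<le> norm y * K"
      using bounded_linear.pos_bounded[OF cl[OF E_cl]] by blast
    have add: "\<rho> (h + h') = \<rho> h + \<rho> h'" for h h'
    proof -
      have "\<rho> (h + h') = \<rho> (\<pi> (l h + l h'))"
        by (simp add: linear_simps[OF cl[OF \<pi>(1)]] l)
      also have "\<dots> = \<rho> h + \<rho> h'"
        unfolding \<rho>_\<pi> by (simp add: linear_simps[OF cl[OF E_cl]] \<rho>_def)
      finally show ?thesis .
    qed
    have scale: "\<rho> (c *\<^sub>C h) = c *\<^sub>C \<rho> h" for c h
    proof -
      have "\<rho> (c *\<^sub>C h) = \<rho> (\<pi> (c *\<^sub>C l h))"
        using \<pi>(1) by (simp add: bounded_clinear_def l)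
      also have "\<dots> = c *\<^sub>C \<rho> h"
        unfolding \<rho>_\<pi> using E_cl by (simp add: bounded_clinear_def \<rho>_def)
      finally show ?thesis .
    qed
    have "norm (\<rho> h) \<le> norm h * (2 * K)" for h
    proof -
      have "norm (\<rho> h) \<le> norm (l h) * K" unfolding \<rho>_def by (rule K)
      also have "\<dots> \<le> 2 * norm h * K" using K(1) by (intro mult_right_mono l) simp
      finally show ?thesis by (simp add: mult_ac)
    qed
    then show ?thesis
      unfolding bounded_clinear_def
      by (intro conjI allI bounded_linear_intro[where K = "2 * K"])
        (simp_all add: add scale scaleR_scaleC)
  qed
  have \<rho>_T: "\<rho> (T i h) = creation i (\<rho> h)" for i h
    using \<rho>_\<pi>[of "creation i (l h)"] by (simp add: \<pi> l E_creation \<rho>_def)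
  have \<rho>_mem: "\<rho> h \<in> N" for h by (simp add: \<rho>_def E_mem)
  have N: "closed_csubspace N"
  proof -
    have "N = \<Psi> -` {0}" by (auto simp: N_def)
    moreover have "closed (\<Psi> -` {0})"
      by (rule closed_vimage[OF closed_singleton])
        (use linear_continuous_on[OF cl[OF \<Psi>(1)]] in auto)
    ultimately have "closed N" by simp
    then show ?thesis
      using \<Psi>(1) linear_simps[OF cl[OF \<Psi>(1)]]
      by (auto simp: closed_csubspace_def N_def bounded_clinear_def)
  qed
  have invariant: "\<forall>i. \<forall>y\<in>N. creation i y \<in> N"
    by (simp add: N_def \<Psi> linear_simps[OF cl[OF bounded_clinear_creation]])
  obtain W and C :: "('m, 's) fock \<Rightarrow> ('m, ('m, 's) fock) fock" and U
    where W: "closed_csubspace W" "W \<subseteq> N" and C: "bounded_clinear C" and U: "bounded_clinear U"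
      and C_mem: "\<And>x. x \<in> N \<Longrightarrow> C x \<in> fock_over W" and U_mem: "\<And>f. f \<in> fock_over W \<Longrightarrow> U f \<in> N"
      and UC: "\<And>x. x \<in> N \<Longrightarrow> U (C x) = x" and CU: "\<And>f. f \<in> fock_over W \<Longrightarrow> C (U f) = f"
      and C_creation: "\<And>i x. x \<in> N \<Longrightarrow> C (creation i x) = creation i (C x)"
    using invariant_subspace_Wold[OF N invariant] by blast
  define F where "F = {h. \<rho> h \<in> W}"
  have \<pi>_F: "\<pi> w \<in> F" "\<rho> (\<pi> w) = w" if "w \<in> W" for w
    using that W(2) by (auto simp: F_def \<rho>_\<pi> E_id)
  have F: "closed_csubspace F"
  proof -
    have "F = \<rho> -` W" by (auto simp: F_def)
    moreover have "closed (\<rho> -` W)"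
      by (rule closed_vimage)
        (use W(1) linear_continuous_on[OF cl[OF \<rho>_cl]] in \<open>auto simp: closed_csubspace_def\<close>)
    ultimately have "closed F" by simp
    then show ?thesis
      using \<rho>_cl linear_simps[OF cl[OF \<rho>_cl]] W(1)
      by (auto simp: closed_csubspace_def F_def bounded_clinear_def)
  qed
  define X where "X h = ell2_map \<pi> (C (\<rho> h))" for h
  define Y where "Y f = \<pi> (U (ell2_map \<rho> f))" for f :: "('m, 'h) fock"
  have X_cl: "bounded_clinear X"
    unfolding X_def[abs_def]
    by (intro bounded_clinear_compose[OF bounded_clinear_ell2_map[OF \<pi>(1)]]
        bounded_clinear_compose[OF C] \<rho>_cl)
  have Y_cl: "bounded_clinear Y"
    unfolding Y_def[abs_def]
    by (intro bounded_clinear_compose[OF \<pi>(1)] bounded_clinear_compose[OF U]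
        bounded_clinear_ell2_map \<rho>_cl)
  have X_mem: "X h \<in> fock_over F" for h
    using C_mem[OF \<rho>_mem, of h] by (auto simp: X_def fock_over_def nth_ell2_map[OF \<pi>(1)] \<pi>_F)
  have X_T: "X (T i h) = creation i (X h)" for i h
    by (simp add: X_def \<rho>_T C_creation \<rho>_mem ell2_map_creation[OF \<pi>(1)])
  have YX: "Y (X h) = h" for h
  proof -
    have "ell2_map \<rho> (X h) = C (\<rho> h)"
      using C_mem[OF \<rho>_mem, of h]
      by (intro ell2_eqI)
        (simp add: X_def nth_ell2_map[OF \<pi>(1)] nth_ell2_map[OF \<rho>_cl] fock_over_def \<pi>_F)
    then show ?thesis by (simp add: Y_def UC \<rho>_mem \<pi>_\<rho>)
  qed
  have XY: "X (Y f) = f" if f: "f \<in> fock_over F" for f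
  proof -
    have "ell2_map \<rho> f \<in> fock_over W"
      using f by (simp add: fock_over_def F_def nth_ell2_map[OF \<rho>_cl])
    then have "C (\<rho> (Y f)) = ell2_map \<rho> f"
      by (simp add: Y_def \<rho>_\<pi> E_id U_mem CU)
    then show ?thesis
      by (intro ell2_eqI)
        (simp add: X_def nth_ell2_map[OF \<pi>(1)] nth_ell2_map[OF \<rho>_cl] \<pi>_\<rho>)
  qed
  have "module_map (hilbert_module T) (hilbert_submodule (fock_over F) creation) X"
    unfolding module_map_def
  proof (intro conjI allI ballI)
    show "bounded_operator (hilbert_module T) (hilbert_submodule (fock_over F) creation) X"
      by (rule bounded_operator_hilbert_submodule[OF X_cl X_mem])
    show "X (mact (hilbert_module T) p x)
        = mact (hilbert_submodule (fock_over F) creation) p (X x)" for p x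
      using intertwiner_eval_poly[OF X_cl, of UNIV UNIV T creation]
      by (simp add: hilbert_submodule_def X_T)
  qed
  moreover have "bounded_operator (hilbert_submodule (fock_over F) creation) (hilbert_module T) Y"
    by (rule bounded_operator_hilbert_submodule[OF Y_cl]) simp
  ultimately have "similar (hilbert_module T) (hilbert_submodule (fock_over F) creation)"
    unfolding similar_def by (intro exI[of _ X] exI[of _ Y]) (simp add: hilbert_submodule_def YX XY)
  then show ?thesis using F by blast
qed

text \<open>
  The corona construction is carried out for real linear operators.
  Averaging over multiplication by \<open>1\<close> and \<open>\<i>\<close> restores complex linearity and preserves the equations
  that a left inverse has to satisfy.
\<close>

lemma bounded_clinear_average:
  fixes A :: "'a::complex_hilbert_space \<Rightarrow> 'b::complex_hilbert_space"
  assumes "bounded_linear A"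
  shows "bounded_clinear (\<lambda>x. (1/2) *\<^sub>R (A x - \<i> *\<^sub>C A (\<i> *\<^sub>C x)))" (is "bounded_clinear ?B")
proof -
  interpret A: bounded_linear A by fact
  have i_linear: "bounded_linear (\<lambda>x::'x::complex_hilbert_space. \<i> *\<^sub>C x)"
    by (rule bounded_linear_intro[where K = 1])
      (simp_all add: scaleC_add_right scaleR_scaleC scaleC_scaleC norm_scaleC mult.commute)
  have lin: "bounded_linear ?B"
    by (rule bounded_linear_compose[OF bounded_linear_scaleR_right bounded_linear_sub[OF assms
            bounded_linear_compose[OF i_linear bounded_linear_compose[OF assms i_linear]]]])
  have ii: "\<i> *\<^sub>C \<i> *\<^sub>C x = - x" for x :: "'x::complex_hilbert_space"
    by (simp add: scaleC_scaleC scaleC_minus_one)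
  have B_i: "?B (\<i> *\<^sub>C x) = \<i> *\<^sub>C ?B x" for x
    by (simp add: ii A.neg linear_simps[OF i_linear] algebra_simps)
  have "?B (c *\<^sub>C x) = c *\<^sub>C ?B x" for c x
  proof -
    have c: "c *\<^sub>C y = Re c *\<^sub>R y + Im c *\<^sub>R (\<i> *\<^sub>C y)" for y :: "'x::complex_hilbert_space"
      by (simp add: scaleR_scaleC scaleC_scaleC scaleC_add_left[symmetric])
        (metis complex_eq mult.commute)
    show ?thesis
      unfolding c[of x] c[of "?B x"] linear_simps[OF lin] B_i ..
  qed
  then show ?thesis using lin by (simp add: bounded_clinear_def)
qed

text \<open>
  The similarity composed with the quotient map is a multi-analytic operator \<open>A\<close> onto the free module
  \<open>D\<close>, with the range of \<open>\<Theta>\<close> as its kernel.  If \<open>B\<close> is a multi-analytic right inverse of \<open>A\<close>, then \<open>I - B A\<close>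
  maps into that kernel and fixes it pointwise, and \<open>\<Psi>\<close> is \<open>I - B A\<close> followed by the inverse of the
  isometry \<open>\<Theta>\<close>.
\<close>

lemma similar_imp_left_invertible:
  fixes T :: "'m::finite \<Rightarrow> 'h \<Rightarrow> 'h::complex_hilbert_space"
    and \<Theta> :: "('m, 'e::complex_hilbert_space) fock \<Rightarrow> ('m, 's::complex_hilbert_space) fock"
    and F :: "'f::complex_hilbert_space set"
  assumes char: "characteristic_operator T \<Theta>" and F: "closed_csubspace F"
    and sim: "similar (hilbert_module T) (hilbert_submodule (fock_over F) creation)"
  shows "left_invertible \<Theta>"
proof -
  note cl = bounded_clinear_linear
  define D :: "('m, 'f) fock set" where "D = fock_over F"
  obtain \<pi> where \<pi>: "bounded_clinear \<pi>" "\<And>i y. \<pi> (creation i y) = T i (\<pi> y)"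
    and ker: "\<And>y. \<pi> y = 0 \<longleftrightarrow> y \<in> range \<Theta>"
    and lift: "\<And>h. \<exists>y. \<pi> y = h \<and> norm y \<le> 2 * norm h"
    using characteristic_operator_quotient_map[OF char] by metis
  have \<Theta>: "bounded_clinear \<Theta>" "\<And>i x. \<Theta> (creation i x) = creation i (\<Theta> x)"
    and norm_\<Theta>: "\<And>g. norm (\<Theta> g) = norm g"
    using char by (auto simp: characteristic_operator_def multi_analytic_def fun_eq_iff)
  obtain X Y where X: "module_map (hilbert_module T) (hilbert_submodule D creation) X"
    and Y: "bounded_operator (hilbert_submodule D creation) (hilbert_module T) Y"
    and YX: "\<And>x. Y (X x) = x" and XY: "\<And>y. y \<in> D \<Longrightarrow> X (Y y) = y"
    using sim by (auto simp: similar_def D_def hilbert_submodule_def)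
  have X_mem: "X h \<in> D" and X_add: "X (h + h') = X h + X h'" and X_scale: "X (c *\<^sub>C h) = c *\<^sub>C X h"
    and X_act: "X (eval_poly T p h) = eval_poly creation p (X h)" for h h' c p
    using X by (auto simp: module_map_def bounded_operator_def hilbert_submodule_def)
  obtain K where K: "\<And>h. norm (X h) \<le> K * norm h"
    using X by (auto simp: module_map_def bounded_operator_def hilbert_submodule_def)
  obtain K' where K': "\<And>y. y \<in> D \<Longrightarrow> norm (Y y) \<le> K' * norm y"
    using Y unfolding bounded_operator_def hilbert_submodule_def by auto metis
  have X_cl: "bounded_clinear X"
    unfolding bounded_clinear_def
    by (intro conjI allI bounded_linear_intro[where K = K])
      (simp_all add: X_add X_scale scaleR_scaleC K mult.commute[of _ K])
  have X_T: "X (T i h) = creation i (X h)" for i h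
    using X_act[of "Poly_Mapping.single [i] 1" h] by simp
  define A where "A y = X (\<pi> y)" for y
  have A_linear: "bounded_linear A"
    unfolding A_def[abs_def] by (rule bounded_linear_compose[OF cl[OF X_cl] cl[OF \<pi>(1)]])
  have A_creation: "A (creation i y) = creation i (A y)" for i y
    by (simp add: A_def \<pi> X_T)
  have "X 0 = 0" by (rule linear_simps(3)[OF cl[OF X_cl]])
  then have A_ker: "A y = 0 \<longleftrightarrow> y \<in> range \<Theta>" for y
    using YX[of "\<pi> y"] YX[of 0] ker[of y] by (auto simp: A_def)
  define c where "c = 2 * \<bar>K'\<bar> + 1"
  \<comment> \<open>Quantitative surjectivity of \<open>A\<close>; by duality it bounds the adjoint from below.\<close>
  have A_lift: "\<exists>y. A y = x \<and> norm y \<le> c * norm x" if x: "x \<in> D" for x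
  proof -
    obtain y where y: "\<pi> y = Y x" "norm y \<le> 2 * norm (Y x)" using lift by blast
    have "norm (Y x) \<le> \<bar>K'\<bar> * norm x"
      using K'[OF x] mult_right_mono[OF abs_ge_self[of K'] norm_ge_zero[of x]] by linarith
    then have "norm y \<le> 2 * (\<bar>K'\<bar> * norm x) + norm x"
      using y(2) norm_ge_zero[of x] by linarith
    then have "norm y \<le> c * norm x" by (simp add: c_def distrib_right mult.assoc)
    moreover have "A y = x" using y(1) by (simp add: A_def XY x)
    ultimately show ?thesis by blast
  qed
  note sub = closed_csubspace_subspace[OF F]
  interpret surjective_multi_analytic A D "1 / c"
  proof (rule surjective_multi_analytic.intro)
    show "subspace D"
      using sub(1)
      by (auto simp: subspace_def D_def fock_over_def zero_ell2.rep_eq plus_ell2.rep_eq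
          scaleR_ell2.rep_eq)
    have "D = (\<Inter>w. (\<lambda>f. ell2_nth f w) -` F)" by (auto simp: D_def fock_over_def)
    moreover have "closed ((\<lambda>f :: ('m, 'f) fock. ell2_nth f w) -` F)" for w
      by (rule closed_vimage[OF sub(2) linear_continuous_on[OF nth_linear]])
    ultimately show "closed D" by auto
    show "creation i f \<in> D" if "f \<in> D" for i f
      using that subspace_0[OF sub(1)]
      by (auto simp: D_def fock_over_def creation.rep_eq split: list.splits)
    show "annihilation i f \<in> D" if "f \<in> D" for i f
      using that by (auto simp: D_def fock_over_def annihilation.rep_eq)
    show "0 < 1 / c" by (simp add: c_def)
    show "1 / c * norm x \<le> norm (adjoint A x)" if x: "x \<in> D" for x
    proof (cases "x = 0")
      case False
      obtain y where y: "A y = x" "norm y \<le> c * norm x" using A_lift[OF x] by blast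
      have "(norm x)\<^sup>2 = inner y (adjoint A x)"
        using inner_adjoint[OF A_linear, of y x] by (simp add: y power2_norm_eq_inner)
      also have "\<dots> \<le> norm y * norm (adjoint A x)" by (rule norm_cauchy_schwarz)
      also have "\<dots> \<le> c * norm x * norm (adjoint A x)" by (intro mult_right_mono y) simp
      finally have "norm x \<le> c * norm (adjoint A x)"
        using False by (simp add: power2_eq_square)
      then show ?thesis by (simp add: c_def field_simps)
    qed simp
    show "A f \<in> D" for f by (simp add: A_def X_mem)
  qed (rule A_linear A_creation)+
  obtain B where B: "bounded_linear B" "\<And>i x. B (creation i x) = creation i (B x)"
    and AB: "\<And>x. x \<in> D \<Longrightarrow> A (B x) = x"
    using multi_analytic_right_inverse by blast
  define R where "R y = y - B (A y)" for y
  have R_linear: "bounded_linear R"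
    unfolding R_def[abs_def]
    by (intro bounded_linear_sub bounded_linear_ident bounded_linear_compose[OF B(1) A_linear])
  have "R y \<in> range \<Theta>" for y
    using A_ker[of "R y"] A_mem[of y] by (simp add: R_def linear_simps[OF A_linear] AB)
  then have "\<exists>g. \<Theta> g = R y" for y by (metis rangeE)
  then obtain \<Psi> where \<Psi>: "\<And>y. \<Theta> (\<Psi> y) = R y" by metis
  have \<Theta>_inj: "g = g'" if "\<Theta> g = \<Theta> g'" for g g'
    using norm_\<Theta>[of "g - g'"] that by (simp add: linear_simps[OF cl[OF \<Theta>(1)]])
  obtain K'' where K'': "\<And>y. norm (R y) \<le> norm y * K''"
    using bounded_linear.bounded[OF R_linear] by blast
  have \<Psi>_linear: "bounded_linear \<Psi>"
  proof (rule bounded_linear_intro[where K = K''])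
    show "\<Psi> (x + y) = \<Psi> x + \<Psi> y" for x y
      by (rule \<Theta>_inj) (simp add: linear_simps[OF cl[OF \<Theta>(1)]] \<Psi> linear_simps[OF R_linear])
    show "\<Psi> (r *\<^sub>R x) = r *\<^sub>R \<Psi> x" for r x
      by (rule \<Theta>_inj) (simp add: linear_simps[OF cl[OF \<Theta>(1)]] \<Psi> linear_simps[OF R_linear])
    show "norm (\<Psi> y) \<le> norm y * K''" for y
      using K''[of y] norm_\<Theta>[of "\<Psi> y"] by (simp add: \<Psi>)
  qed
  have \<Psi>_creation: "\<Psi> (creation i y) = creation i (\<Psi> y)" for i y
    by (rule \<Theta>_inj)
      (simp add: \<Psi> \<Theta> R_def A_creation B linear_simps[OF cl[OF bounded_clinear_creation]])
  have "A (\<Theta> g) = 0" for g using A_ker[of "\<Theta> g"] by simp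
  then have \<Psi>\<Theta>: "\<Psi> (\<Theta> g) = g" for g
    by (intro \<Theta>_inj) (simp add: \<Psi> R_def linear_simps[OF B(1)])
  define \<Phi> where "\<Phi> y = (1/2) *\<^sub>R (\<Psi> y - \<i> *\<^sub>C \<Psi> (\<i> *\<^sub>C y))" for y
  have "bounded_clinear \<Phi>"
    unfolding \<Phi>_def[abs_def] by (rule bounded_clinear_average[OF \<Psi>_linear])
  moreover have "\<Phi> (creation i y) = creation i (\<Phi> y)" for i y
    by (simp add: \<Phi>_def creation_scaleC[symmetric] \<Psi>_creation
        linear_simps[OF cl[OF bounded_clinear_creation]])
  moreover have "\<Phi> (\<Theta> g) = g" for g
  proof -
    have "\<i> *\<^sub>C \<Theta> g = \<Theta> (\<i> *\<^sub>C g)" using \<Theta>(1) by (simp add: bounded_clinear_def)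
    then show ?thesis
      by (simp add: \<Phi>_def \<Psi>\<Theta> scaleC_scaleC scaleC_minus_one scaleR_2[symmetric])
  qed
  ultimately show ?thesis
    unfolding left_invertible_def multi_analytic_def by (intro exI[of _ \<Phi>]) (auto simp: fun_eq_iff)
qed

(* HOL cannot quantify existentially over types.  "Some Hilbert space F" is stated twice: F ranges
   over the closed subspaces of an arbitrary Hilbert space type 'f where F is given, and over those
   of 'h where F has to be found.  The latter loses nothing: a Hilbert space F such that the Fock
   module over F is similar to the module on 'h embeds boundedly, with closed range, into 'h, and is
   therefore unitarily equivalent to a closed subspace of 'h. *)
theorem theorem5p2:
  fixes T :: "'m::finite \<Rightarrow> 'h \<Rightarrow> 'h::complex_hilbert_space"
    and \<Theta> :: "('m, 'e::complex_hilbert_space) fock \<Rightarrow> ('m, 's::complex_hilbert_space) fock"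
  assumes "pure_cospherically_contractive T"
    and "characteristic_operator T \<Theta>"
  shows "((\<exists>F :: 'h set. closed_csubspace F \<and>
            similar (hilbert_module T) (hilbert_submodule (fock_over F) creation))
          \<longleftrightarrow> left_invertible \<Theta>)
       \<and> ((\<exists>F :: 'f::complex_hilbert_space set. closed_csubspace F \<and>
            similar (hilbert_module T) (hilbert_submodule (fock_over F) creation))
          \<longrightarrow> left_invertible \<Theta>)"
proof (intro conjI iffI impI)
  show "left_invertible \<Theta>" if "\<exists>F :: 'h set. closed_csubspace F \<and>
      similar (hilbert_module T) (hilbert_submodule (fock_over F) creation)"
    using that similar_imp_left_invertible[OF assms(2)] by blast
  show "left_invertible \<Theta>" if "\<exists>F :: 'f set. closed_csubspace F \<and>
      similar (hilbert_module T) (hilbert_submodule (fock_over F) creation)"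
    using that similar_imp_left_invertible[OF assms(2)] by blast
qed (rule left_invertible_imp_similar[OF assms(2)])

end
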